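(* Let $p>0$, $q\in\mathbb{R}$, and suppose that the kernel $k\in C^0([0,1])$ achieves Input-to-State Stabilization with gain $\frac{\gamma}{p\pi^2}\ge0$ of the system $$u_t(t,x)=p\,u_{xx}(t,x)-q\,u(t,x)+v(t,x)\ (t>0,\ x\in(0,1)),\qquad u(t,0)=0,\quad u(t,1)=U(t)\ (t>0).$$ Let $f:L^2(0,1)\to L^2(0,1)$ be a continuous mapping. Suppose that there exist functions $\varphi_i\in C^2([0,1])$ with $\varphi_i(0)=0$ ($i=1,\ldots,n$), continuous functionals $K_i:L^2(0,1)\to\mathbb{R}$ ($i=1,\ldots,n$), and constants $M\ge0$, $P_i\ge0$, $\omega_i>0$ ($i=1,\ldots,n$), such that $$|K_i(u)|\le P_i\|u\|\quad\text{for }i=1,\ldots,n\text{ and }u\in L^2(0,1),$$ $$\left\|f(u)-\sum_{i=1}^n\varphi_iK_i(u)\right\|\le M\|u\|\quad\text{for all }u\in L^2(0,1),$$ and $$\frac{\gamma}{p\pi^2}\left(M+\sum_{i=1}^n\omega_i^{-2}P_i\left\|p\varphi_i''-(q-\omega_i^2)\varphi_i\right\|\right)+\sum_{i=1}^n\omega_i^{-2}P_i\|\varphi_i\|<1.$$ Then $0\in L^2(0,1)\times\mathbb{R}^n$ is globally exponentially stable for the closed-loop system $$u_t(t,x)=p\,u_{xx}(t,x)-q\,u(t,x)+(f(u[t]))(x)\quad(t>0,\ x\in(0,1)),$$ $$u(t,0)=0,\qquad u(t,1)=\sum_{i=1}^n\varphi_i(1)\xi_i(t)+\int_0^1k(x)u(t,x)\,dx-\sum_{i=1}^n\xi_i(t)\int_0^1\varphi_i(x)k(x)\,dx\quad(t>0),$$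 $$\dot\xi_i(t)=-\omega_i^2\xi_i(t)+K_i(u[t])\quad(t>0),\qquad i=1,\ldots,n,$$ i.e., there exist constants $R,\delta>0$ such that every solution $u\in C^0(\mathbb{R}_+;L^2(0,1))\cap C^1((0,+\infty)\times[0,1])$, $\xi_i\in C^0(\mathbb{R}_+)\cap C^1((0,+\infty))$, $i=1,\ldots,n$, with $u[t]\in C^2([0,1])$ for $t>0$, of this closed-loop system satisfies $$\|u[t]\|+\sum_{i=1}^n|\xi_i(t)|\le R\exp(-\delta t)\left(\|u[0]\|+\sum_{i=1}^n|\xi_i(0)|\right)\quad\text{for all }t\ge0.$$
   Context: Notation: $\mathbb{R}_+=[0,+\infty)$; $\|\cdot\|$ is the norm of $L^2(0,1)$, $\|g\|=\left(\int_0^1|g(x)|^2dx\right)^{1/2}$; for $u:\mathbb{R}_+\times[0,1]\to\mathbb{R}$, $u[t]$ denotes the profile $(u[t])(x)=u(t,x)$; $C^0(\mathbb{R}_+;L^2(0,1))$ is the class of functions for which $t\mapsto u[t]\in L^2(0,1)$ is continuous. Definition (Input-to-State Stabilization). Consider $u_t=p u_{xx}-q u+v$ for $t>0$, $x\in(0,1)$, with $u(t,0)=0$, $u(t,1)=U(t)$ for $t>0$, where $v:\mathbb{R}_+\times[0,1]\to\mathbb{R}$ is a distributed input (with $v[t]\in L^2(0,1)$) and $U$ is the control input. A kernel $k\in C^0([0,1])$ achieves Input-to-State Stabilization with gain $g\ge 0$ of this system if there exist constants $G,\sigma>0$ such that (for every distributed input $v$) every solution $u\in C^0(\mathbb{R}_+;L^2(0,1))\cap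 C^1((0,+\infty)\times[0,1])$ with $u[t]\in C^2([0,1])$ for $t>0$ of the closed-loop system with $U(t)=\int_0^1k(x)u(t,x)\,dx$ for $t>0$ satisfies $$\|u[t]\|\le G\exp(-\sigma t)\|u[0]\|+g\sup_{0\le s\le t}\|v[s]\|\quad\text{for all }t\ge 0.$$ *)

theory Defs
  imports "HOL-Analysis.Analysis"
begin

abbreviation unit_lebesgue :: "real measure" where
  "unit_lebesgue \<equiv> lebesgue_on {0<..<1}"

text \<open>
  Elements of $L^2(0,1)$ are represented by functions, identified when they agree almost
  everywhere on $(0,1)$; values outside $(0,1)$ are irrelevant. Accordingly \<open>L2norm\<close> is a
  seminorm on representatives.
\<close>

definition L2_space :: "(real \<Rightarrow> real) set" where
  "L2_space = {g. g \<in> borel_measurable unit_lebesgue \<and> integrable unit_lebesgue (\<lambda>x. (g x)\<^sup>2)}"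

definition L2norm :: "(real \<Rightarrow> real) \<Rightarrow> real" where
  "L2norm g = sqrt (LINT x|unit_lebesgue. (g x)\<^sup>2)"

text \<open>
  Continuity with respect to the seminorm forces almost-everywhere equal arguments to have
  almost-everywhere equal images (respectively equal values, for functionals), so the maps below
  are exactly those that induce continuous maps on $L^2(0,1)$.
\<close>

definition L2_continuous_map :: "((real \<Rightarrow> real) \<Rightarrow> (real \<Rightarrow> real)) \<Rightarrow> bool" where
  "L2_continuous_map f \<longleftrightarrow>
     (\<forall>w\<in>L2_space. f w \<in> L2_space) \<and>
     (\<forall>w\<in>L2_space. \<forall>\<epsilon>>0. \<exists>\<delta>>0. \<forall>z\<in>L2_space.
        L2norm (\<lambda>x. z x - w x) < \<delta> \<longrightarrow> L2norm (\<lambda>x. f z x - f w x) < \<epsilon>)"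

definition L2_continuous_functional :: "((real \<Rightarrow> real) \<Rightarrow> real) \<Rightarrow> bool" where
  "L2_continuous_functional K \<longleftrightarrow>
     (\<forall>w\<in>L2_space. \<forall>\<epsilon>>0. \<exists>\<delta>>0. \<forall>z\<in>L2_space.
        L2norm (\<lambda>x. z x - w x) < \<delta> \<longrightarrow> \<bar>K z - K w\<bar> < \<epsilon>)"

text \<open>The class $C^2([0,1])$, with one-sided derivatives at the end points.\<close>

definition C2_unit :: "(real \<Rightarrow> real) \<Rightarrow> bool" where
  "C2_unit g \<longleftrightarrow> (\<exists>g' g''.
     (\<forall>x\<in>{0..1}. (g has_real_derivative g' x) (at x within {0..1})) \<and>
     (\<forall>x\<in>{0..1}. (g' has_real_derivative g'' x) (at x within {0..1})) \<and>
     continuous_on {0..1} g'')"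

text \<open>
  In what follows \<open>u t x\<close> stands for $u(t,x)$, so that \<open>u t\<close> is the profile $u[t]$; only its values
  for $t \ge 0$ and $x \in [0,1]$ matter.
\<close>

text \<open>The class $C^0(\mathbb{R}_+;L^2(0,1))$.\<close>

definition C0_L2 :: "(real \<Rightarrow> real \<Rightarrow> real) \<Rightarrow> bool" where
  "C0_L2 u \<longleftrightarrow>
     (\<forall>t\<ge>0. u t \<in> L2_space) \<and>
     (\<forall>t\<ge>0. ((\<lambda>s. L2norm (\<lambda>x. u s x - u t x)) \<longlongrightarrow> 0) (at t within {0..}))"

text \<open>
  The class $C^1((0,+\infty)\times[0,1])$: both partial derivatives exist (one-sided in $x$ at the
  end points) and are jointly continuous; joint continuity of \<open>u\<close> is a consequence.
\<close>

definition C1_strip :: "(real \<Rightarrow> real \<Rightarrow> real) \<Rightarrow> bool" where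
  "C1_strip u \<longleftrightarrow> (\<exists>ut ux.
     (\<forall>t>0. \<forall>x\<in>{0..1}. ((\<lambda>s. u s x) has_real_derivative ut t x) (at t)) \<and>
     (\<forall>t>0. \<forall>x\<in>{0..1}. (u t has_real_derivative ux t x) (at x within {0..1})) \<and>
     continuous_on ({0<..} \<times> {0..1}) (\<lambda>(t, x). ut t x) \<and>
     continuous_on ({0<..} \<times> {0..1}) (\<lambda>(t, x). ux t x))"

definition solution_class :: "(real \<Rightarrow> real \<Rightarrow> real) \<Rightarrow> bool" where
  "solution_class u \<longleftrightarrow> C0_L2 u \<and> C1_strip u \<and> (\<forall>t>0. C2_unit (u t))"

definition linear_loop_solution ::
  "real \<Rightarrow> real \<Rightarrow> (real \<Rightarrow> real) \<Rightarrow> (real \<Rightarrow> real \<Rightarrow> real) \<Rightarrow> (real \<Rightarrow> real \<Rightarrow> real) \<Rightarrow> bool" where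
  "linear_loop_solution p q k v u \<longleftrightarrow>
     solution_class u \<and>
     (\<forall>t>0. \<forall>x\<in>{0<..<1}.
        deriv (\<lambda>s. u s x) t = p * (deriv ^^ 2) (u t) x - q * u t x + v t x) \<and>
     (\<forall>t>0. u t 0 = 0) \<and>
     (\<forall>t>0. u t 1 = (LINT x|unit_lebesgue. k x * u t x))"

text \<open>
  The supremum in the gain estimate is taken in $[0,+\infty]$, the estimate being void where it is
  infinite. Since the supremum of an unbounded set of reals has no meaningful value, this is
  expressed by the condition \<open>bdd_above\<close>.
\<close>

definition achieves_ISS ::
  "real \<Rightarrow> real \<Rightarrow> (real \<Rightarrow> real) \<Rightarrow> real \<Rightarrow> bool" where
  "achieves_ISS p q k g \<longleftrightarrow>
     continuous_on {0..1} k \<and> g \<ge> 0 \<and>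
     (\<exists>G>0. \<exists>\<sigma>>0. \<forall>v u.
        (\<forall>t\<ge>0. v t \<in> L2_space) \<longrightarrow> linear_loop_solution p q k v u \<longrightarrow>
        (\<forall>t\<ge>0. bdd_above ((\<lambda>s. L2norm (v s)) ` {0..t}) \<longrightarrow>
           L2norm (u t) \<le> G * exp (- \<sigma> * t) * L2norm (u 0)
                           + g * (SUP s\<in>{0..t}. L2norm (v s))))"

text \<open>
  As \<open>f (u t)\<close> represents an element of $L^2(0,1)$, its values are determined only almost
  everywhere; the differential equation therefore says that, for each $t>0$, the function
  $u_t - p u_{xx} + q u$ is a representative of $f(u[t])$.
\<close>

definition closed_loop_solution ::
  "real \<Rightarrow> real \<Rightarrow> (real \<Rightarrow> real) \<Rightarrow> ((real \<Rightarrow> real) \<Rightarrow> (real \<Rightarrow> real)) \<Rightarrow> nat \<Rightarrow>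
   (nat \<Rightarrow> real \<Rightarrow> real) \<Rightarrow> (nat \<Rightarrow> (real \<Rightarrow> real) \<Rightarrow> real) \<Rightarrow> (nat \<Rightarrow> real) \<Rightarrow>
   (real \<Rightarrow> real \<Rightarrow> real) \<Rightarrow> (nat \<Rightarrow> real \<Rightarrow> real) \<Rightarrow> bool" where
  "closed_loop_solution p q k f n \<phi> K \<omega> u \<xi> \<longleftrightarrow>
     solution_class u \<and>
     (\<forall>i\<in>{1..n}. continuous_on {0..} (\<xi> i) \<and> \<xi> i C1_differentiable_on {0<..}) \<and>
     (\<forall>t>0. AE x in unit_lebesgue.
        deriv (\<lambda>s. u s x) t = p * (deriv ^^ 2) (u t) x - q * u t x + f (u t) x) \<and>
     (\<forall>t>0. u t 0 = 0) \<and>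
     (\<forall>t>0. u t 1 = (\<Sum>i=1..n. \<phi> i 1 * \<xi> i t)
                      + (LINT x|unit_lebesgue. k x * u t x)
                      - (\<Sum>i=1..n. \<xi> i t * (LINT x|unit_lebesgue. \<phi> i x * k x))) \<and>
     (\<forall>i\<in>{1..n}. \<forall>t>0. deriv (\<xi> i) t = - (\<omega> i)\<^sup>2 * \<xi> i t + K i (u t))"

end

theory Submission
  imports Defs
begin

text \<open>
  The controller is designed so that the change of variables
  $w(t,x) = u(t,x) - \sum_i \xi_i(t)\varphi_i(x)$ removes the terms $\varphi_i K_i(u)$ from the
  equation and turns the boundary condition of the closed loop into the linear feedback
  $w(t,1) = \int_0^1 k w\,dx$. What remains is a solution of the linear loop whose distributed input
  is $f(u) - \sum_i \varphi_i K_i(u) + \sum_i \xi_i\psi_i$ with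
  $\psi_i = p\varphi_i'' - (q-\omega_i^2)\varphi_i$
  (lemma \<open>closed_loop_reduces_to_linear_loop\<close>); its norm is at most
  $M\|u\| + \sum_i |\xi_i|\,\|\psi_i\|$. Input-to-state stability bounds $w$ by this input,
  the filters bound $\xi_i$ by $\omega_i^{-2}P_i\sup\|u\|$, and $u$ is recovered from $w$ and $\xi$ by
  $\|u\| \le \|w\| + \sum_i|\xi_i|\,\|\varphi_i\|$. Going once around this circle multiplies the size
  of $u$ by the left-hand side of the last hypothesis, which is less than one.

  With plain suprema this small-gain argument gives boundedness only. Exponential decay comes from
  running it with the weighted suprema $\sup_s e^{\delta s}\|u[s]\|$ for a small $\delta > 0$. For
  the filters the gain becomes $(\omega_i^2-\delta)^{-1}P_i$. For the linear loop, time invariance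
  allows the estimate to be restarted at any time (lemma \<open>achieves_ISS_restart\<close>), and an estimate
  that can be restarted has a weighted version with a gain arbitrarily close to the original one
  (lemma \<open>fading_memory_estimate\<close>). Since the hypothesis is a strict inequality, it survives both
  perturbations, and the weighted supremum is bounded by a multiple of the initial data
  (lemma \<open>small_gain_decay\<close>).
\<close>

section \<open>The seminorm of $L^2(0,1)$\<close>

lemma finite_measure_unit_lebesgue: "finite_measure unit_lebesgue"
  by (intro finite_measure_lebesgue_on lmeasurable_interval)

lemma continuous_imp_integrable_unit:
  fixes h :: "real \<Rightarrow> real"
  assumes "continuous_on {0..1} h"
  shows "integrable unit_lebesgue h"
proof -
  have "bounded (h ` {0..1})"
    using assms by (intro compact_imp_bounded compact_continuous_image) auto
  then obtain B where B: "\<And>x. x \<in> {0..1} \<Longrightarrow> norm (h x) \<le> B"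
    unfolding bounded_iff by (metis imageI)
  have "h \<in> borel_measurable unit_lebesgue"
  proof (rule continuous_imp_measurable_on_sets_lebesgue)
    show "continuous_on {0<..<1} h" using assms by (rule continuous_on_subset) auto
  qed simp
  moreover have "AE x in unit_lebesgue. norm (h x) \<le> B"
    using B by (intro AE_I2) simp
  ultimately show ?thesis
    by (intro finite_measure.integrable_const_bound[OF finite_measure_unit_lebesgue])
qed

lemma continuous_in_L2_space:
  assumes "continuous_on {0..1} h"
  shows "h \<in> L2_space"
proof -
  have "integrable unit_lebesgue (\<lambda>x. (h x)\<^sup>2)"
    by (intro continuous_imp_integrable_unit continuous_on_power assms)
  moreover have "h \<in> borel_measurable unit_lebesgue"
    using continuous_imp_integrable_unit[OF assms] by (rule borel_measurable_integrable)
  ultimately show ?thesis unfolding L2_space_def by blast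
qed

lemma L2_space_cong:
  assumes "\<And>x. x \<in> {0<..<1} \<Longrightarrow> f x = g x"
  shows "f \<in> L2_space \<longleftrightarrow> g \<in> L2_space"
proof -
  have "f \<in> borel_measurable unit_lebesgue \<longleftrightarrow> g \<in> borel_measurable unit_lebesgue"
    using assms by (intro measurable_cong) simp
  moreover have "integrable unit_lebesgue (\<lambda>x. (f x)\<^sup>2) \<longleftrightarrow> integrable unit_lebesgue (\<lambda>x. (g x)\<^sup>2)"
    using assms by (intro Bochner_Integration.integrable_cong) simp_all
  ultimately show ?thesis unfolding L2_space_def by simp
qed

lemma L2norm_cong_AE:
  assumes "f \<in> borel_measurable unit_lebesgue" "g \<in> borel_measurable unit_lebesgue"
    and "AE x in unit_lebesgue. f x = g x"
  shows "L2norm f = L2norm g"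
  unfolding L2norm_def
proof (rule arg_cong[where f=sqrt], rule integral_cong_AE)
  show "AE x in unit_lebesgue. (f x)\<^sup>2 = (g x)\<^sup>2" using assms(3) by auto
qed (use assms(1,2) in simp_all)

lemma L2norm_nonneg [simp]: "0 \<le> L2norm f"
  unfolding L2norm_def by simp

lemma L2norm_power2: "(L2norm f)\<^sup>2 = (LINT x|unit_lebesgue. (f x)\<^sup>2)"
  unfolding L2norm_def by simp

lemma L2norm_scale: "L2norm (\<lambda>x. c * f x) = \<bar>c\<bar> * L2norm f"
  unfolding L2norm_def by (simp add: power_mult_distrib real_sqrt_mult)

lemma L2_space_scale: "f \<in> L2_space \<Longrightarrow> (\<lambda>x. c * f x) \<in> L2_space"
  unfolding L2_space_def by (auto simp: power_mult_distrib)

text \<open>Convexity of the square: the weights \<open>a\<close> and \<open>b\<close> are free, and the triangle inequality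
  arises by taking them to be the norms of the summands.\<close>

lemma power2_add_le_weighted:
  fixes a b y z :: real
  assumes "a > 0" "b > 0"
  shows "(y + z)\<^sup>2 \<le> (a + b) * (y\<^sup>2 / a + z\<^sup>2 / b)"
proof -
  have "(a + b) * (y\<^sup>2 / a + z\<^sup>2 / b) - (y + z)\<^sup>2 = (b * y - a * z)\<^sup>2 / (a * b)"
    using assms by (simp add: field_simps power2_eq_square)
  also have "\<dots> \<ge> 0" using assms by simp
  finally show ?thesis by simp
qed

lemma L2_space_add:
  assumes "f \<in> L2_space" "g \<in> L2_space"
  shows "(\<lambda>x. f x + g x) \<in> L2_space"
proof -
  have [measurable]: "f \<in> borel_measurable unit_lebesgue" "g \<in> borel_measurable unit_lebesgue"
    and "integrable unit_lebesgue (\<lambda>x. (f x)\<^sup>2)" "integrable unit_lebesgue (\<lambda>x. (g x)\<^sup>2)"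
    using assms by (auto simp: L2_space_def)
  then have "integrable unit_lebesgue (\<lambda>x. 2 * ((f x)\<^sup>2 + (g x)\<^sup>2))" by simp
  then have "integrable unit_lebesgue (\<lambda>x. (f x + g x)\<^sup>2)"
  proof (rule Bochner_Integration.integrable_bound)
    show "AE x in unit_lebesgue. norm ((f x + g x)\<^sup>2) \<le> norm (2 * ((f x)\<^sup>2 + (g x)\<^sup>2))"
      using power2_add_le_weighted[of 1 1] by (intro AE_I2) simp
  qed measurable
  then show ?thesis by (auto simp: L2_space_def)
qed

lemma L2_space_diff:
  assumes "f \<in> L2_space" "g \<in> L2_space"
  shows "(\<lambda>x. f x - g x) \<in> L2_space"
  using L2_space_add[OF assms(1) L2_space_scale[OF assms(2), of "-1"]] by simp

lemma L2_space_zero: "(\<lambda>x. 0) \<in> L2_space"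
  by (simp add: L2_space_def)

lemma L2_space_sum:
  "(\<And>i. i \<in> I \<Longrightarrow> f i \<in> L2_space) \<Longrightarrow> (\<lambda>x. \<Sum>i\<in>I. f i x) \<in> L2_space"
  by (induction I rule: infinite_finite_induct) (auto intro!: L2_space_add L2_space_zero)

lemma L2norm_triangle:
  assumes "f \<in> L2_space" "g \<in> L2_space"
  shows "L2norm (\<lambda>x. f x + g x) \<le> L2norm f + L2norm g"
proof -
  \<comment> \<open>Strict upper bounds serve as weights, since the norms themselves may vanish.\<close>
  have bound: "L2norm (\<lambda>x. f x + g x) \<le> a + b" if a: "L2norm f < a" and b: "L2norm g < b" for a b
  proof -
    have pos: "a > 0" "b > 0" using a b L2norm_nonneg[of f] L2norm_nonneg[of g] by linarith+
    have int: "integrable unit_lebesgue (\<lambda>x. (f x)\<^sup>2)" "integrable unit_lebesgue (\<lambda>x. (g x)\<^sup>2)"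
      using assms by (auto simp: L2_space_def)
    have "(L2norm (\<lambda>x. f x + g x))\<^sup>2
        \<le> (LINT x|unit_lebesgue. (a + b) * ((f x)\<^sup>2 / a + (g x)\<^sup>2 / b))"
      unfolding L2norm_power2
      using L2_space_add[OF assms] int power2_add_le_weighted[OF pos]
      by (intro integral_mono) (auto simp: L2_space_def)
    also have "\<dots> = (a + b) * ((L2norm f)\<^sup>2 / a + (L2norm g)\<^sup>2 / b)"
      unfolding L2norm_power2 using int by simp
    also have "\<dots> \<le> (a + b) * (a\<^sup>2 / a + b\<^sup>2 / b)"
      using pos a b by (intro mult_left_mono add_mono divide_right_mono power_mono) auto
    also have "\<dots> = (a + b)\<^sup>2" using pos by (simp add: power2_eq_square)
    finally show ?thesis by (rule power2_le_imp_le) (use pos in simp)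
  qed
  show ?thesis
  proof (rule field_le_epsilon)
    fix e :: real assume "e > 0"
    then show "L2norm (\<lambda>x. f x + g x) \<le> L2norm f + L2norm g + e"
      using bound[of "L2norm f + e/2" "L2norm g + e/2"] by simp
  qed
qed

lemma L2norm_diff_le:
  assumes "f \<in> L2_space" "g \<in> L2_space"
  shows "L2norm (\<lambda>x. f x - g x) \<le> L2norm f + L2norm g"
  using L2norm_triangle[OF assms(1) L2_space_scale[OF assms(2), of "-1"]]
    L2norm_scale[of "-1" g] by simp

lemma L2norm_sum_le:
  "(\<And>i. i \<in> I \<Longrightarrow> f i \<in> L2_space) \<Longrightarrow>
    L2norm (\<lambda>x. \<Sum>i\<in>I. f i x) \<le> (\<Sum>i\<in>I. L2norm (f i))"
proof (induction I rule: infinite_finite_induct)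
  case (insert i I)
  then show ?case
    using L2norm_triangle[of "f i" "\<lambda>x. \<Sum>i\<in>I. f i x"] L2_space_sum[of I f] by force
qed (auto simp: L2norm_def)

lemma L2norm_lincomb_le:
  assumes "\<And>i. i \<in> I \<Longrightarrow> h i \<in> L2_space"
  shows "L2norm (\<lambda>x. \<Sum>i\<in>I. c i * h i x) \<le> (\<Sum>i\<in>I. \<bar>c i\<bar> * L2norm (h i))"
  using L2norm_sum_le[of I "\<lambda>i x. c i * h i x"] assms
  by (simp add: L2_space_scale L2norm_scale)

lemma L2norm_reverse_triangle:
  assumes "f \<in> L2_space" "g \<in> L2_space"
  shows "\<bar>L2norm f - L2norm g\<bar> \<le> L2norm (\<lambda>x. f x - g x)"
proof -
  have "L2norm f \<le> L2norm (\<lambda>x. f x - g x) + L2norm g"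
    using L2norm_triangle[OF L2_space_diff[OF assms] assms(2)] by simp
  moreover have "L2norm g \<le> L2norm f + L2norm (\<lambda>x. f x - g x)"
    using L2norm_diff_le[OF assms(1) L2_space_diff[OF assms]] by simp
  ultimately show ?thesis by simp
qed

text \<open>Used to know that the weighted supremum of \<open>L2norm (u s)\<close> over a compact time interval is
  finite and attained.\<close>

lemma continuous_on_L2norm_profile:
  assumes "C0_L2 u"
  shows "continuous_on {0..} (\<lambda>t. L2norm (u t))"
  unfolding continuous_on_def
proof
  fix t :: real assume t: "t \<in> {0..}"
  have "((\<lambda>s. L2norm (u s) - L2norm (u t)) \<longlongrightarrow> 0) (at t within {0..})"
  proof (rule Lim_null_comparison)
    show "((\<lambda>s. L2norm (\<lambda>x. u s x - u t x)) \<longlongrightarrow> 0) (at t within {0..})"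
      using assms t by (auto simp: C0_L2_def)
    show "\<forall>\<^sub>F s in at t within {0..}.
        norm (L2norm (u s) - L2norm (u t)) \<le> L2norm (\<lambda>x. u s x - u t x)"
      using assms t L2norm_reverse_triangle
      by (auto simp: C0_L2_def eventually_at_filter)
  qed
  then show "((\<lambda>t. L2norm (u t)) \<longlongrightarrow> L2norm (u t)) (at t within {0..})"
    using LIM_zero_iff by blast
qed

section \<open>Scalar estimates\<close>

text \<open>An estimate whose gain multiplies a plain supremum of the input, if it may be restarted at
  any time, forgets old inputs exponentially, at the price of an arbitrarily small increase of the
  gain. Over a window of length \<open>T\<close> with \<open>G * exp (- \<sigma> * T) * g' + g < g'\<close>, the restarted estimate
  reproduces the weighted bound; the slow rate \<open>\<delta>\<close> only costs the factor \<open>exp (\<delta> * T)\<close>, close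
  to \<open>1\<close>. All constants depend on \<open>G\<close>, \<open>\<sigma>\<close>, \<open>g\<close>, \<open>g'\<close> alone and not on the trajectory.\<close>

lemma fading_memory_estimate:
  fixes G \<sigma> g g' :: real
  assumes "G > 0" "\<sigma> > 0" "g \<ge> 0" "g < g'"
  obtains G' \<delta>0 where "G' > 0" "\<delta>0 > 0"
    "\<And>\<delta> (a :: real \<Rightarrow> real) b t B.
      \<lbrakk>0 < \<delta>; \<delta> \<le> \<delta>0; 0 \<le> t; 0 \<le> B; \<And>s. 0 \<le> s \<Longrightarrow> 0 \<le> a s;
       \<And>t0 t C. \<lbrakk>0 \<le> t0; t0 \<le> t; \<And>s. s \<in> {t0..t} \<Longrightarrow> b s \<le> C\<rbrakk> \<Longrightarrow>
         a t \<le> G * exp (- \<sigma> * (t - t0)) * a t0 + g * C;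
       \<And>s. s \<in> {0..t} \<Longrightarrow> exp (\<delta> * s) * b s \<le> B\<rbrakk> \<Longrightarrow>
      exp (\<delta> * t) * a t \<le> G' * a 0 + g' * B"
proof -
  have g': "g' > 0" using assms by linarith
  have "((\<lambda>T. G * exp (- \<sigma> * T) * g' + g) \<longlongrightarrow> G * 0 * g' + g) at_top"
  proof (intro tendsto_intros)
    have "filterlim (\<lambda>T. - (\<sigma> * T)) at_bot at_top"
      using assms(2) by (intro filterlim_uminus_at_top[THEN iffD1]
        filterlim_tendsto_pos_mult_at_top[OF tendsto_const] filterlim_ident) auto
    then show "((\<lambda>T. exp (- \<sigma> * T)) \<longlongrightarrow> 0) at_top"
      using filterlim_compose[OF exp_at_bot] by simp
  qed
  then have "\<forall>\<^sub>F T in at_top. G * exp (- \<sigma> * T) * g' + g < g'"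
    using assms by (intro order_tendstoD) auto
  then have "\<forall>\<^sub>F T in at_top. G * exp (- \<sigma> * T) * g' + g < g' \<and> T > 0"
    by (intro eventually_conj eventually_gt_at_top)
  then obtain T where T: "G * exp (- \<sigma> * T) * g' + g < g'" "T > 0"
    by (metis (mono_tags, lifting) eventually_at_top_linorder order_refl)
  define \<eta> where "\<eta> = G * exp (- \<sigma> * T)"
  have \<eta>: "\<eta> > 0" "\<eta> * g' + g < g'" using assms T by (auto simp: \<eta>_def)
  have "((\<lambda>\<delta>. exp (\<delta> * T) * (\<eta> * g' + g)) \<longlongrightarrow> exp (0 * T) * (\<eta> * g' + g)) (at_right 0)"
    by (intro tendsto_intros)
  then have "\<forall>\<^sub>F \<delta> in at_right 0. exp (\<delta> * T) * (\<eta> * g' + g) < g'"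
    using \<eta> by (intro order_tendstoD) auto
  then have "\<forall>\<^sub>F \<delta> in at_right 0. exp (\<delta> * T) * (\<eta> * g' + g) < g' \<and> (0::real) < \<delta>"
    by (intro eventually_conj eventually_at_right_less)
  then obtain \<delta>0 where \<delta>0: "exp (\<delta>0 * T) * (\<eta> * g' + g) < g'" "\<delta>0 > 0"
    using eventually_happens'[OF trivial_limit_at_right_real] by blast
  define E where "E = exp (\<delta>0 * T)"
  have E: "E \<ge> 1" "E * (\<eta> * g' + g) < g'" using \<delta>0 T by (auto simp: E_def)
  have E\<eta>: "E * \<eta> \<le> 1"
  proof -
    have "0 \<le> E * g" using E assms by simp
    then have "(E * \<eta>) * g' \<le> 1 * g'" using E by (simp add: algebra_simps)
    then show ?thesis using g' by simp
  qed
  have Eg: "E * g \<le> g'"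
  proof -
    have "0 \<le> E * (\<eta> * g')" using E \<eta> g' by simp
    then show ?thesis using E by (simp add: algebra_simps)
  qed
  show thesis
  proof (rule that[of "E * G" \<delta>0])
    show "E * G > 0" "\<delta>0 > 0" using assms \<delta>0 E by auto
    fix \<delta> t B :: real and a b :: "real \<Rightarrow> real"
    assume \<delta>: "0 < \<delta>" "\<delta> \<le> \<delta>0" and t: "0 \<le> t" and B: "0 \<le> B"
      and a0: "\<And>s. 0 \<le> s \<Longrightarrow> 0 \<le> a s"
      and est: "\<And>t0 t C. \<lbrakk>0 \<le> t0; t0 \<le> t; \<And>s. s \<in> {t0..t} \<Longrightarrow> b s \<le> C\<rbrakk> \<Longrightarrow>
         a t \<le> G * exp (- \<sigma> * (t - t0)) * a t0 + g * C"
      and b: "\<And>s. s \<in> {0..t} \<Longrightarrow> exp (\<delta> * s) * b s \<le> B"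
    have bs: "b s \<le> exp (- (\<delta> * t0)) * B" if "s \<in> {t0..t}" "0 \<le> t0" for s t0
    proof -
      have "b s = exp (- (\<delta> * s)) * (exp (\<delta> * s) * b s)" by (simp add: mult_exp_exp flip: mult.assoc)
      also have "\<dots> \<le> exp (- (\<delta> * s)) * B" using b[of s] that by (intro mult_left_mono) auto
      also have "\<dots> \<le> exp (- (\<delta> * t0)) * B"
        using that \<delta> B by (intro mult_right_mono) auto
      finally show ?thesis .
    qed
    have expT: "exp (\<delta> * r) \<le> E" if "r \<le> T" "0 \<le> r" for r
      using \<delta> that T unfolding E_def by (simp add: mult_mono)
    \<comment> \<open>Induction on the number of windows of length \<open>T\<close> that are needed to reach the time \<open>r\<close>.\<close>
    have "exp (\<delta> * r) * a r \<le> E * G * a 0 + g' * B" if "0 \<le> r" "r \<le> t" "r < real (Suc m) * T" for r m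
      using that
    proof (induction m arbitrary: r)
      case 0
      have rT: "r \<le> T" using 0 by simp
      have "a r \<le> G * exp (- \<sigma> * (r - 0)) * a 0 + g * B"
        using bs[of _ 0] 0 by (intro est) auto
      also have "\<dots> \<le> G * 1 * a 0 + g * B"
        using 0 assms a0[of 0] by (intro add_right_mono mult_right_mono mult_left_mono) auto
      finally have "exp (\<delta> * r) * a r \<le> exp (\<delta> * r) * (G * a 0 + g * B)"
        by (intro mult_left_mono) auto
      also have "\<dots> \<le> E * (G * a 0 + g * B)"
        using expT[OF rT] 0 assms a0[of 0] B by (intro mult_right_mono) auto
      also have "\<dots> = E * G * a 0 + E * g * B" by (simp add: algebra_simps)
      also have "\<dots> \<le> E * G * a 0 + g' * B"
        using Eg B by (intro add_left_mono mult_right_mono) auto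
      finally show ?case .
    next
      case (Suc m)
      show ?case
      proof (cases "r < real (Suc m) * T")
        case True
        then show ?thesis using Suc by blast
      next
        case False
        have "1 * T \<le> real (Suc m) * T" using T(2) by (intro mult_right_mono) auto
        then have rT: "r \<ge> T" using False by linarith
        define X where "X = E * G * a 0 + g' * B"
        have X: "X \<ge> g' * B" "X \<ge> 0"
          using E assms a0[of 0] B g' by (auto simp: X_def)
        have IH: "exp (\<delta> * (r - T)) * a (r - T) \<le> X"
          unfolding X_def using Suc.prems rT T(2) by (intro Suc.IH) (auto simp: algebra_simps)
        have "a r \<le> G * exp (- \<sigma> * (r - (r - T))) * a (r - T) + g * (exp (- (\<delta> * (r - T))) * B)"
          using bs[of _ "r - T"] rT Suc.prems T(2) by (intro est) auto
        then have "exp (\<delta> * r) * a r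
            \<le> exp (\<delta> * r) * (\<eta> * a (r - T) + g * (exp (- (\<delta> * (r - T))) * B))"
          by (simp add: \<eta>_def)
        also have "\<dots> = exp (\<delta> * T) * (\<eta> * (exp (\<delta> * (r - T)) * a (r - T)) + g * B)"
        proof -
          have split: "exp (\<delta> * r) = exp (\<delta> * T) * exp (\<delta> * (r - T))"
            by (simp add: algebra_simps flip: exp_add)
          have cancel: "exp (\<delta> * r) * exp (- (\<delta> * (r - T))) = exp (\<delta> * T)"
            by (simp add: algebra_simps flip: exp_add)
          have "w * (\<eta> * z + g * (y * B)) = \<eta> * (w * z) + g * ((w * y) * B)" for w y z
            by (simp add: algebra_simps)
          then have "exp (\<delta> * r) * (\<eta> * a (r - T) + g * (exp (- (\<delta> * (r - T))) * B))
              = \<eta> * (exp (\<delta> * r) * a (r - T)) + g * (exp (\<delta> * T) * B)"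
            by (simp only: cancel)
          also have "\<dots> = exp (\<delta> * T) * (\<eta> * (exp (\<delta> * (r - T)) * a (r - T)) + g * B)"
            unfolding split by (simp only: algebra_simps)
          finally show ?thesis .
        qed
        also have "\<dots> \<le> exp (\<delta> * T) * (\<eta> * X + g * B)"
          using IH \<eta> by simp
        also have "\<dots> \<le> E * (\<eta> * X + g * B)"
          using expT[of T] T X \<eta> assms B by (intro mult_right_mono) auto
        \<comment> \<open>The part \<open>g' * B\<close> of the bound is reproduced by the choice of \<open>T\<close> and \<open>\<delta>\<close>; the rest of
          it does not grow because \<open>E * \<eta> \<le> 1\<close>.\<close>
        also have "\<dots> = (E * \<eta>) * (X - g' * B) + E * (\<eta> * g' + g) * B"
          by (simp add: algebra_simps)
        also have "\<dots> \<le> 1 * (X - g' * B) + g' * B"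
          using E\<eta> E X B by (intro add_mono mult_right_mono) auto
        finally show ?thesis by (simp add: X_def)
      qed
    qed
    moreover obtain m where "t < real (Suc m) * T"
      using reals_Archimedean2[of "t / T"] T(2)
      by (metis less_Suc_eq of_nat_less_iff order.strict_trans pos_divide_less_eq lessI)
    ultimately show "exp (\<delta> * t) * a t \<le> E * G * a 0 + g' * B" using t by blast
  qed
qed

text \<open>The filter \<open>\<xi>' = - \<rho> * \<xi> + \<kappa>\<close> with an input decaying at a rate \<open>\<delta> < \<rho>\<close>: by variation of
  constants its weighted gain is \<open>1 / (\<rho> - \<delta>)\<close>.\<close>

lemma filter_upper_bound:
  fixes \<xi> \<kappa> :: "real \<Rightarrow> real"
  assumes "continuous_on {0..} \<xi>" "\<delta> < \<rho>" "0 \<le> t" "0 \<le> C"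
    and der: "\<And>s. 0 < s \<Longrightarrow> (\<xi> has_real_derivative - \<rho> * \<xi> s + \<kappa> s) (at s)"
    and bound: "\<And>s. s \<in> {0<..<t} \<Longrightarrow> exp (\<delta> * s) * \<kappa> s \<le> C"
  shows "exp (\<delta> * t) * \<xi> t \<le> \<bar>\<xi> 0\<bar> + C / (\<rho> - \<delta>)"
proof -
  define \<mu> where "\<mu> = \<rho> - \<delta>"
  have \<mu>: "\<mu> > 0" using assms by (simp add: \<mu>_def)
  \<comment> \<open>Nonincreasing: subtracting the second term cancels the largest growth that the input allows.\<close>
  define F where "F s = exp (\<rho> * s) * \<xi> s - C / \<mu> * exp (\<mu> * s)" for s
  have "F 0 \<ge> F t"
  proof (rule DERIV_nonpos_imp_decreasing_open[OF assms(3)])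
    fix s :: real assume s: "0 < s" "s < t"
    have "(F has_real_derivative exp (\<rho> * s) * \<kappa> s - C * exp (\<mu> * s)) (at s)"
      unfolding F_def using s \<mu>
      by (auto intro!: derivative_eq_intros der simp: field_simps)
    moreover have "exp (\<rho> * s) * \<kappa> s \<le> C * exp (\<mu> * s)"
    proof -
      have "exp (\<rho> * s) * \<kappa> s = exp (\<mu> * s) * (exp (\<delta> * s) * \<kappa> s)"
        by (simp add: \<mu>_def left_diff_distrib mult_exp_exp flip: mult.assoc)
      also have "\<dots> \<le> exp (\<mu> * s) * C" using bound s by simp
      finally show ?thesis by (simp add: mult.commute)
    qed
    ultimately show "\<exists>y. DERIV F s :> y \<and> y \<le> 0" by force
  next
    show "continuous_on {0..t} F"
      unfolding F_def using \<mu> continuous_on_subset[OF assms(1), of "{0..t}"]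
      by (auto intro!: continuous_intros)
  qed
  then have "exp (\<rho> * t) * \<xi> t \<le> \<xi> 0 - C / \<mu> + C / \<mu> * exp (\<mu> * t)"
    by (simp add: F_def)
  also have "\<dots> \<le> exp (\<mu> * t) * \<bar>\<xi> 0\<bar> + exp (\<mu> * t) * (C / \<mu>)"
  proof -
    have "\<xi> 0 \<le> exp (\<mu> * t) * \<bar>\<xi> 0\<bar>"
      using \<mu> assms(3) mult_right_mono[of 1 "exp (\<mu> * t)" "\<bar>\<xi> 0\<bar>"] by simp
    moreover have "0 \<le> C / \<mu>" using \<mu> assms by simp
    ultimately show ?thesis by (simp only: mult.commute[of "C/\<mu>"])
  qed
  also have "exp (\<rho> * t) * \<xi> t = exp (\<mu> * t) * (exp (\<delta> * t) * \<xi> t)"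
    by (simp add: \<mu>_def left_diff_distrib mult_exp_exp flip: mult.assoc)
  finally have "exp (\<mu> * t) * (exp (\<delta> * t) * \<xi> t) \<le> exp (\<mu> * t) * (\<bar>\<xi> 0\<bar> + C / \<mu>)"
    by (simp only: distrib_left)
  then have "exp (\<delta> * t) * \<xi> t \<le> \<bar>\<xi> 0\<bar> + C / \<mu>"
    by (subst (asm) mult_le_cancel_left_pos) simp_all
  then show ?thesis by (simp add: \<mu>_def)
qed

lemma filter_bound:
  fixes \<xi> \<kappa> :: "real \<Rightarrow> real"
  assumes "continuous_on {0..} \<xi>" "\<delta> < \<rho>" "0 \<le> t" "0 \<le> C"
    and der: "\<And>s. 0 < s \<Longrightarrow> (\<xi> has_real_derivative - \<rho> * \<xi> s + \<kappa> s) (at s)"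
    and bound: "\<And>s. s \<in> {0<..<t} \<Longrightarrow> exp (\<delta> * s) * \<bar>\<kappa> s\<bar> \<le> C"
  shows "exp (\<delta> * t) * \<bar>\<xi> t\<bar> \<le> \<bar>\<xi> 0\<bar> + C / (\<rho> - \<delta>)"
proof -
  have b: "exp (\<delta> * s) * \<kappa> s \<le> C" "exp (\<delta> * s) * (- \<kappa> s) \<le> C" if "s \<in> {0<..<t}" for s
  proof -
    have "exp (\<delta> * s) * \<kappa> s \<le> exp (\<delta> * s) * \<bar>\<kappa> s\<bar>" "exp (\<delta> * s) * (- \<kappa> s) \<le> exp (\<delta> * s) * \<bar>\<kappa> s\<bar>"
      by (intro mult_left_mono; simp)+
    then show "exp (\<delta> * s) * \<kappa> s \<le> C" "exp (\<delta> * s) * (- \<kappa> s) \<le> C"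
      using bound[OF that] by linarith+
  qed
  have "exp (\<delta> * t) * \<xi> t \<le> \<bar>\<xi> 0\<bar> + C / (\<rho> - \<delta>)"
    using assms b by (intro filter_upper_bound) auto
  moreover have "exp (\<delta> * t) * (- \<xi> t) \<le> \<bar>- \<xi> 0\<bar> + C / (\<rho> - \<delta>)"
    using assms(1-4) b
    by (intro filter_upper_bound[where \<kappa>="\<lambda>s. - \<kappa> s"])
      (auto intro!: continuous_intros derivative_eq_intros der)
  ultimately show ?thesis by (simp add: abs_if split: if_splits)
qed

text \<open>The small-gain argument for the norms alone: \<open>N\<close> stands for the norm of the state \<open>u\<close>, \<open>a\<close> for
  that of the transformed state \<open>w\<close>, \<open>b\<close> for that of its input and \<open>\<xi> i\<close> for the filter states. On
  \<open>{0..t}\<close> let \<open>B\<close> be the maximum of \<open>exp (\<delta> * s) * N s\<close>. The filters and the weighted estimate for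
  \<open>a\<close> bound \<open>B\<close> by \<open>L \<delta> * B\<close> plus a multiple of the initial data, where \<open>L \<delta>\<close> tends to the loop gain
  as \<open>\<delta>\<close> tends to \<open>0\<close> and \<open>g'\<close> to \<open>g\<close>. The constants are obtained before the trajectories are
  quantified, which makes the decay uniform over all solutions.\<close>

lemma small_gain_decay:
  fixes I :: "'i set" and P c d \<rho> :: "'i \<Rightarrow> real"
  assumes "finite I" and "G > 0" "\<sigma> > 0" "g \<ge> 0" "M \<ge> 0"
    and nonneg: "\<And>i. i \<in> I \<Longrightarrow> P i \<ge> 0" "\<And>i. i \<in> I \<Longrightarrow> c i \<ge> 0" "\<And>i. i \<in> I \<Longrightarrow> d i \<ge> 0"
    and \<rho>: "\<And>i. i \<in> I \<Longrightarrow> \<rho> i > 0"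
    and gain: "g * (M + (\<Sum>i\<in>I. P i * c i / \<rho> i)) + (\<Sum>i\<in>I. P i * d i / \<rho> i) < 1"
  obtains R \<delta> where "R > 0" "\<delta> > 0"
    "\<And>(N :: real \<Rightarrow> real) a b \<xi> \<kappa> t.
      \<lbrakk>continuous_on {0..} N; \<And>s. 0 \<le> s \<Longrightarrow> 0 \<le> N s; \<And>s. 0 \<le> s \<Longrightarrow> 0 \<le> a s;
       \<And>t0 t C. \<lbrakk>0 \<le> t0; t0 \<le> t; \<And>s. s \<in> {t0..t} \<Longrightarrow> b s \<le> C\<rbrakk> \<Longrightarrow>
         a t \<le> G * exp (- \<sigma> * (t - t0)) * a t0 + g * C;
       \<And>s. 0 \<le> s \<Longrightarrow> b s \<le> M * N s + (\<Sum>i\<in>I. c i * \<bar>\<xi> i s\<bar>);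
       \<And>s. 0 \<le> s \<Longrightarrow> N s \<le> a s + (\<Sum>i\<in>I. d i * \<bar>\<xi> i s\<bar>);
       a 0 \<le> N 0 + (\<Sum>i\<in>I. d i * \<bar>\<xi> i 0\<bar>);
       \<And>i. i \<in> I \<Longrightarrow> continuous_on {0..} (\<xi> i);
       \<And>i s. i \<in> I \<Longrightarrow> 0 < s \<Longrightarrow> (\<xi> i has_real_derivative - \<rho> i * \<xi> i s + \<kappa> i s) (at s);
       \<And>i s. i \<in> I \<Longrightarrow> 0 < s \<Longrightarrow> \<bar>\<kappa> i s\<bar> \<le> P i * N s; 0 \<le> t\<rbrakk> \<Longrightarrow>
      N t + (\<Sum>i\<in>I. \<bar>\<xi> i t\<bar>) \<le> R * exp (- \<delta> * t) * (N 0 + (\<Sum>i\<in>I. \<bar>\<xi> i 0\<bar>))"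
proof -
  have "((\<lambda>g'. g' * (M + (\<Sum>i\<in>I. P i * c i / \<rho> i)) + (\<Sum>i\<in>I. P i * d i / \<rho> i))
      \<longlongrightarrow> g * (M + (\<Sum>i\<in>I. P i * c i / \<rho> i)) + (\<Sum>i\<in>I. P i * d i / \<rho> i)) (at_right g)"
    by (intro tendsto_intros)
  then have "\<forall>\<^sub>F g' in at_right g.
      g' * (M + (\<Sum>i\<in>I. P i * c i / \<rho> i)) + (\<Sum>i\<in>I. P i * d i / \<rho> i) < 1"
    using gain by (intro order_tendstoD)
  then have "\<forall>\<^sub>F g' in at_right g.
      g' * (M + (\<Sum>i\<in>I. P i * c i / \<rho> i)) + (\<Sum>i\<in>I. P i * d i / \<rho> i) < 1 \<and> g < g'"
    by (intro eventually_conj eventually_at_right_less)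
  then obtain g' where gain': "g' * (M + (\<Sum>i\<in>I. P i * c i / \<rho> i)) + (\<Sum>i\<in>I. P i * d i / \<rho> i) < 1"
    and g': "g < g'"
    using eventually_happens'[OF trivial_limit_at_right_real] by blast
  have g'0: "g' \<ge> 0" using g' assms by simp
  obtain G' \<delta>0 where G': "G' > 0" "\<delta>0 > 0" and fading:
    "\<And>\<delta> (a :: real \<Rightarrow> real) b t B.
      \<lbrakk>0 < \<delta>; \<delta> \<le> \<delta>0; 0 \<le> t; 0 \<le> B; \<And>s. 0 \<le> s \<Longrightarrow> 0 \<le> a s;
       \<And>t0 t C. \<lbrakk>0 \<le> t0; t0 \<le> t; \<And>s. s \<in> {t0..t} \<Longrightarrow> b s \<le> C\<rbrakk> \<Longrightarrow>
         a t \<le> G * exp (- \<sigma> * (t - t0)) * a t0 + g * C;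
       \<And>s. s \<in> {0..t} \<Longrightarrow> exp (\<delta> * s) * b s \<le> B\<rbrakk> \<Longrightarrow>
      exp (\<delta> * t) * a t \<le> G' * a 0 + g' * B"
    using fading_memory_estimate[OF \<open>G > 0\<close> \<open>\<sigma> > 0\<close> \<open>g \<ge> 0\<close> g'] by metis
  define L where
    "L \<delta> = g' * (M + (\<Sum>i\<in>I. P i * c i / (\<rho> i - \<delta>))) + (\<Sum>i\<in>I. P i * d i / (\<rho> i - \<delta>))" for \<delta>
  have "(L \<longlongrightarrow> L 0) (at_right 0)"
    unfolding L_def using \<rho> by (intro tendsto_intros) (auto simp: less_imp_neq[THEN not_sym])
  moreover have "L 0 < 1" using gain' by (simp add: L_def)
  ultimately have "\<forall>\<^sub>F \<delta> in at_right 0. L \<delta> < 1"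
    by (rule order_tendstoD)
  moreover have "\<forall>\<^sub>F \<delta> in at_right 0. \<delta> < e" if "e > 0" for e :: real
    using that by (auto simp: eventually_at_right)
  ultimately have "\<forall>\<^sub>F \<delta> in at_right 0. L \<delta> < 1 \<and> \<delta> < \<delta>0 \<and> (\<forall>i\<in>I. \<delta> < \<rho> i) \<and> 0 < \<delta>"
    using G' \<rho> \<open>finite I\<close>
    by (intro eventually_conj eventually_at_right_less eventually_ball_finite) auto
  then obtain \<delta> where L: "L \<delta> < 1" and \<delta>: "\<delta> < \<delta>0" "\<And>i. i \<in> I \<Longrightarrow> \<delta> < \<rho> i" "0 < \<delta>"
    using eventually_happens'[OF trivial_limit_at_right_real] by blast
  define D where "D = (\<Sum>i\<in>I. d i)"
  define C where "C = (\<Sum>i\<in>I. c i)"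
  define H where "H = (\<Sum>i\<in>I. P i / (\<rho> i - \<delta>))"
  define Q where "Q = (G' * (1 + D) + g' * C + D) / (1 - L \<delta>)"
  have \<rho>\<delta>: "0 \<le> \<rho> i - \<delta>" if "i \<in> I" for i using \<delta>(2)[OF that] by simp
  have const_nonneg: "D \<ge> 0" "C \<ge> 0" "H \<ge> 0"
    using nonneg \<rho>\<delta> by (auto simp: D_def C_def H_def intro!: sum_nonneg divide_nonneg_nonneg)
  then have Q: "Q \<ge> 0" using G' g'0 L by (simp add: Q_def)
  show thesis
  proof (rule that[of "Q * (1 + H) + 1" \<delta>])
    show "Q * (1 + H) + 1 > 0" "\<delta> > 0"
      using Q const_nonneg \<delta> by (auto intro!: add_nonneg_pos)
    fix N a b :: "real \<Rightarrow> real" and \<xi> \<kappa> :: "'i \<Rightarrow> real \<Rightarrow> real" and t :: real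
    assume N: "continuous_on {0..} N" "\<And>s. 0 \<le> s \<Longrightarrow> 0 \<le> N s"
      and a: "\<And>s. 0 \<le> s \<Longrightarrow> 0 \<le> a s"
      and est: "\<And>t0 t C. \<lbrakk>0 \<le> t0; t0 \<le> t; \<And>s. s \<in> {t0..t} \<Longrightarrow> b s \<le> C\<rbrakk> \<Longrightarrow>
         a t \<le> G * exp (- \<sigma> * (t - t0)) * a t0 + g * C"
      and b: "\<And>s. 0 \<le> s \<Longrightarrow> b s \<le> M * N s + (\<Sum>i\<in>I. c i * \<bar>\<xi> i s\<bar>)"
      and Na: "\<And>s. 0 \<le> s \<Longrightarrow> N s \<le> a s + (\<Sum>i\<in>I. d i * \<bar>\<xi> i s\<bar>)"
      and a0: "a 0 \<le> N 0 + (\<Sum>i\<in>I. d i * \<bar>\<xi> i 0\<bar>)"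
      and \<xi>: "\<And>i. i \<in> I \<Longrightarrow> continuous_on {0..} (\<xi> i)"
        "\<And>i s. i \<in> I \<Longrightarrow> 0 < s \<Longrightarrow> (\<xi> i has_real_derivative - \<rho> i * \<xi> i s + \<kappa> i s) (at s)"
      and \<kappa>: "\<And>i s. i \<in> I \<Longrightarrow> 0 < s \<Longrightarrow> \<bar>\<kappa> i s\<bar> \<le> P i * N s"
      and t: "0 \<le> t"
    define x where "x = (\<Sum>i\<in>I. \<bar>\<xi> i 0\<bar>)"
    have x0: "x \<ge> 0" by (simp add: x_def sum_nonneg)
    have weighted_x: "(\<Sum>i\<in>I. e i * \<bar>\<xi> i 0\<bar>) \<le> (\<Sum>i\<in>I. e i) * x"
      if "\<And>i. i \<in> I \<Longrightarrow> e i \<ge> 0" for e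
      unfolding sum_distrib_right x_def
      using that \<open>finite I\<close> member_le_sum[of _ I "\<lambda>i. \<bar>\<xi> i 0\<bar>"]
      by (intro sum_mono mult_left_mono) auto
    have "continuous_on {0..t} (\<lambda>s. exp (\<delta> * s) * N s)"
      using continuous_on_subset[OF N(1), of "{0..t}"] by (auto intro!: continuous_intros)
    \<comment> \<open>Working at a maximum point \<open>s\<close> makes the bound at \<open>s\<close> an inequality for \<open>B\<close> itself.\<close>
    then obtain s where s: "s \<in> {0..t}"
      and smax: "\<And>r. r \<in> {0..t} \<Longrightarrow> exp (\<delta> * r) * N r \<le> exp (\<delta> * s) * N s"
      using continuous_attains_sup[of "{0..t}" "\<lambda>s. exp (\<delta> * s) * N s"] t by auto
    define B where "B = exp (\<delta> * s) * N s"
    have B: "B \<ge> 0" "\<And>r. r \<in> {0..t} \<Longrightarrow> exp (\<delta> * r) * N r \<le> B"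
      using s N smax by (auto simp: B_def)
    have \<xi>_bound: "exp (\<delta> * r) * \<bar>\<xi> i r\<bar> \<le> \<bar>\<xi> i 0\<bar> + P i * B / (\<rho> i - \<delta>)"
      if i: "i \<in> I" and r: "r \<in> {0..t}" for i r
    proof (rule filter_bound[OF \<xi>(1)[OF i] \<delta>(2)[OF i] _ _ \<xi>(2)[OF i]])
      fix y assume y: "y \<in> {0<..<r}"
      have "exp (\<delta> * y) * \<bar>\<kappa> i y\<bar> \<le> exp (\<delta> * y) * (P i * N y)"
        using \<kappa>[OF i] y by (intro mult_left_mono) auto
      also have "\<dots> = P i * (exp (\<delta> * y) * N y)" by simp
      also have "\<dots> \<le> P i * B" using B y r nonneg i by (intro mult_left_mono) auto
      finally show "exp (\<delta> * y) * \<bar>\<kappa> i y\<bar> \<le> P i * B" .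
    qed (use r B nonneg i in auto)
    have sum_bound: "exp (\<delta> * r) * (\<Sum>i\<in>I. e i * \<bar>\<xi> i r\<bar>)
        \<le> (\<Sum>i\<in>I. e i) * x + (\<Sum>i\<in>I. P i * e i / (\<rho> i - \<delta>)) * B"
      if e: "\<And>i. i \<in> I \<Longrightarrow> e i \<ge> 0" and r: "r \<in> {0..t}" for e r
    proof -
      have "exp (\<delta> * r) * (\<Sum>i\<in>I. e i * \<bar>\<xi> i r\<bar>) = (\<Sum>i\<in>I. e i * (exp (\<delta> * r) * \<bar>\<xi> i r\<bar>))"
        by (simp add: sum_distrib_left algebra_simps)
      also have "\<dots> \<le> (\<Sum>i\<in>I. e i * (\<bar>\<xi> i 0\<bar> + P i * B / (\<rho> i - \<delta>)))"
        using e r \<xi>_bound by (intro sum_mono mult_left_mono) auto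
      also have "\<dots> = (\<Sum>i\<in>I. e i * \<bar>\<xi> i 0\<bar>) + (\<Sum>i\<in>I. P i * e i / (\<rho> i - \<delta>)) * B"
        by (simp add: distrib_left sum.distrib sum_distrib_left sum_distrib_right mult_ac)
      also have "(\<Sum>i\<in>I. e i * \<bar>\<xi> i 0\<bar>) \<le> (\<Sum>i\<in>I. e i) * x"
        using e by (rule weighted_x)
      finally show ?thesis by simp
    qed
    define Sc where "Sc = (\<Sum>i\<in>I. P i * c i / (\<rho> i - \<delta>))"
    define Sd where "Sd = (\<Sum>i\<in>I. P i * d i / (\<rho> i - \<delta>))"
    have Sc: "Sc \<ge> 0"
      using nonneg \<rho>\<delta> by (auto simp: Sc_def intro!: sum_nonneg divide_nonneg_nonneg mult_nonneg_nonneg)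
    have "exp (\<delta> * s) * a s \<le> G' * a 0 + g' * (M * B + (C * x + Sc * B))"
    proof (rule fading[OF \<delta>(3) _ _ _ a est])
      fix r assume "r \<in> {0..s}"
      then have r: "r \<in> {0..t}" "0 \<le> r" using s by auto
      have "exp (\<delta> * r) * b r \<le> M * (exp (\<delta> * r) * N r) + exp (\<delta> * r) * (\<Sum>i\<in>I. c i * \<bar>\<xi> i r\<bar>)"
        using mult_left_mono[OF b[OF r(2)], of "exp (\<delta> * r)"] by (simp add: algebra_simps)
      also have "\<dots> \<le> M * B + (C * x + Sc * B)"
        unfolding C_def Sc_def using r B nonneg \<open>M \<ge> 0\<close>
        by (intro add_mono mult_left_mono sum_bound) auto
      finally show "exp (\<delta> * r) * b r \<le> M * B + (C * x + Sc * B)" .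
    qed (use s \<delta> B x0 Sc const_nonneg \<open>M \<ge> 0\<close> in auto)
    moreover have "B \<le> exp (\<delta> * s) * a s + exp (\<delta> * s) * (\<Sum>i\<in>I. d i * \<bar>\<xi> i s\<bar>)"
      using Na[of s] s by (simp add: B_def flip: distrib_left)
    moreover have "exp (\<delta> * s) * (\<Sum>i\<in>I. d i * \<bar>\<xi> i s\<bar>) \<le> D * x + Sd * B"
      unfolding D_def Sd_def using s nonneg by (intro sum_bound) auto
    moreover have "G' * a 0 \<le> G' * (N 0 + D * x)"
      using a0 weighted_x[of d] nonneg G' by (intro mult_left_mono) (auto simp: D_def)
    ultimately have "B \<le> G' * (N 0 + D * x) + g' * (M * B + (C * x + Sc * B)) + (D * x + Sd * B)"
      by linarith
    then have "(1 - L \<delta>) * B \<le> G' * (N 0 + D * x) + g' * C * x + D * x"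
      by (simp add: L_def Sc_def Sd_def algebra_simps)
    also have "\<dots> \<le> (G' * (1 + D) + g' * C + D) * (N 0 + x)"
    proof -
      have "0 \<le> G' * x + G' * D * N 0 + g' * C * N 0 + D * N 0"
        using G' g'0 const_nonneg x0 N by simp
      then show ?thesis by (simp add: algebra_simps)
    qed
    finally have BQ: "B \<le> Q * (N 0 + x)"
      using L by (simp add: Q_def field_simps)
    have "exp (\<delta> * t) * (N t + (\<Sum>i\<in>I. 1 * \<bar>\<xi> i t\<bar>)) \<le> B + (\<Sum>i\<in>I. exp (\<delta> * t) * \<bar>\<xi> i t\<bar>)"
      using B(2)[of t] t by (simp add: distrib_left sum_distrib_left)
    also have "\<dots> \<le> B + (\<Sum>i\<in>I. \<bar>\<xi> i 0\<bar> + P i * B / (\<rho> i - \<delta>))"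
      using \<xi>_bound t by (intro add_left_mono sum_mono) auto
    also have "\<dots> = B * (1 + H) + x"
      by (simp add: x_def H_def sum.distrib sum_distrib_left algebra_simps)
    also have "\<dots> \<le> (Q * (N 0 + x)) * (1 + H) + (N 0 + x)"
      using BQ const_nonneg N(2)[of 0] by (intro add_mono mult_right_mono) auto
    also have "\<dots> = (Q * (1 + H) + 1) * (N 0 + x)" by (simp add: algebra_simps)
    finally show "N t + (\<Sum>i\<in>I. \<bar>\<xi> i t\<bar>)
        \<le> (Q * (1 + H) + 1) * exp (- \<delta> * t) * (N 0 + (\<Sum>i\<in>I. \<bar>\<xi> i 0\<bar>))"
      by (simp add: x_def exp_minus field_simps)
  qed
qed

section \<open>Twice differentiable profiles\<close>

lemma C2_unit_imp_continuous:
  assumes "C2_unit g"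
  shows "continuous_on {0..1} g"
  using assms unfolding C2_unit_def by (metis DERIV_continuous_on)

text \<open>Inside the interval the one-sided derivatives of a \<open>C2_unit\<close> function are ordinary ones.\<close>

lemma second_deriv_eq_interior:
  assumes "\<And>x. x \<in> {0..1} \<Longrightarrow> (g has_real_derivative g' x) (at x within {0..1})"
    and "\<And>x. x \<in> {0..1} \<Longrightarrow> (g' has_real_derivative g'' x) (at x within {0..1})"
    and "x \<in> {0<..<1}"
  shows "(deriv ^^ 2) g x = g'' x"
proof -
  have at: "at y within {0..1} = at y" if "y \<in> {0<..<1}" for y :: real
    using that by (intro at_within_interior) (simp add: interior_atLeastAtMost_real)
  have d: "deriv g y = g' y" if "y \<in> {0<..<1}" for y
    using assms(1)[of y] that at[OF that] by (intro DERIV_imp_deriv) auto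
  have "(g' has_real_derivative g'' x) (at x)"
    using assms(2)[of x] assms(3) at[OF assms(3)] by auto
  moreover have "\<forall>\<^sub>F y in nhds x. y \<in> {0<..<1}"
    using assms(3) by (intro eventually_nhds_in_open) auto
  then have "\<forall>\<^sub>F y in nhds x. deriv g y = g' y"
    by eventually_elim (rule d)
  ultimately have "(deriv g has_real_derivative g'' x) (at x)"
    using DERIV_cong_ev[OF refl _ refl] by metis
  then show ?thesis
    by (simp add: numeral_2_eq_2 DERIV_imp_deriv)
qed

lemma C2_unit_second_deriv:
  assumes "C2_unit g"
  obtains g'' where "continuous_on {0..1} g''"
    "\<And>x. x \<in> {0<..<1} \<Longrightarrow> (deriv ^^ 2) g x = g'' x"
  using assms second_deriv_eq_interior unfolding C2_unit_def by metis

lemma C2_unit_diff_lincomb: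
  assumes "C2_unit g" "\<And>i. i \<in> I \<Longrightarrow> C2_unit (\<phi> i)"
  shows "C2_unit (\<lambda>x. g x - (\<Sum>i\<in>I. c i * \<phi> i x))"
    and "x \<in> {0<..<1} \<Longrightarrow> (deriv ^^ 2) (\<lambda>x. g x - (\<Sum>i\<in>I. c i * \<phi> i x)) x
          = (deriv ^^ 2) g x - (\<Sum>i\<in>I. c i * (deriv ^^ 2) (\<phi> i) x)"
proof -
  obtain g' g'' where g: "\<And>x. x \<in> {0..1} \<Longrightarrow> (g has_real_derivative g' x) (at x within {0..1})"
    "\<And>x. x \<in> {0..1} \<Longrightarrow> (g' has_real_derivative g'' x) (at x within {0..1})"
    "continuous_on {0..1} g''"
    using assms(1) unfolding C2_unit_def by blast
  have "\<forall>i. \<exists>h h'. i \<in> I \<longrightarrow>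
      (\<forall>x\<in>{0..1}. (\<phi> i has_real_derivative h x) (at x within {0..1})) \<and>
      (\<forall>x\<in>{0..1}. (h has_real_derivative h' x) (at x within {0..1})) \<and> continuous_on {0..1} h'"
    using assms(2) unfolding C2_unit_def by blast
  then obtain h h' where h: "\<And>i x. i \<in> I \<Longrightarrow> x \<in> {0..1} \<Longrightarrow> (\<phi> i has_real_derivative h i x) (at x within {0..1})"
    "\<And>i x. i \<in> I \<Longrightarrow> x \<in> {0..1} \<Longrightarrow> (h i has_real_derivative h' i x) (at x within {0..1})"
    "\<And>i. i \<in> I \<Longrightarrow> continuous_on {0..1} (h' i)"
    by metis
  define w where "w x = g x - (\<Sum>i\<in>I. c i * \<phi> i x)" for x
  define w' where "w' x = g' x - (\<Sum>i\<in>I. c i * h i x)" for x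
  define w'' where "w'' x = g'' x - (\<Sum>i\<in>I. c i * h' i x)" for x
  have w: "(w has_real_derivative w' x) (at x within {0..1})" if "x \<in> {0..1}" for x
    unfolding w_def w'_def using that
    by (intro DERIV_diff DERIV_sum DERIV_cmult g h)
  have w': "(w' has_real_derivative w'' x) (at x within {0..1})" if "x \<in> {0..1}" for x
    unfolding w'_def w''_def using that
    by (intro DERIV_diff DERIV_sum DERIV_cmult g h)
  have "continuous_on {0..1} w''"
    unfolding w''_def by (intro continuous_intros g h)
  then have "C2_unit w"
    unfolding C2_unit_def using w w' by blast
  then show "C2_unit (\<lambda>x. g x - (\<Sum>i\<in>I. c i * \<phi> i x))"
    unfolding w_def .
  assume x: "x \<in> {0<..<1}"
  have "(deriv ^^ 2) w x = w'' x"
    using w w' x by (rule second_deriv_eq_interior)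
  moreover have "(deriv ^^ 2) g x = g'' x"
    using g(1,2) x by (rule second_deriv_eq_interior)
  moreover have "(deriv ^^ 2) (\<phi> i) x = h' i x" if "i \<in> I" for i
    using h(1,2)[OF that] x by (rule second_deriv_eq_interior)
  ultimately show "(deriv ^^ 2) (\<lambda>x. g x - (\<Sum>i\<in>I. c i * \<phi> i x)) x
          = (deriv ^^ 2) g x - (\<Sum>i\<in>I. c i * (deriv ^^ 2) (\<phi> i) x)"
    unfolding w_def w''_def by simp
qed

section \<open>Operations on solutions\<close>

lemma C1_strip_deriv:
  assumes "C1_strip u" "t > 0" "x \<in> {0..1}"
  shows "((\<lambda>s. u s x) has_real_derivative deriv (\<lambda>s. u s x) t) (at t)"
proof -
  obtain D where "((\<lambda>s. u s x) has_real_derivative D) (at t)"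
    using assms unfolding C1_strip_def by blast
  then show ?thesis using DERIV_imp_deriv by metis
qed

lemma C1_strip_continuous_deriv:
  assumes "C1_strip u" "t > 0"
  shows "continuous_on {0..1} (\<lambda>x. deriv (\<lambda>s. u s x) t)"
proof -
  obtain ut where ut: "\<And>t x. t > 0 \<Longrightarrow> x \<in> {0..1} \<Longrightarrow> ((\<lambda>s. u s x) has_real_derivative ut t x) (at t)"
    and cont: "continuous_on ({0<..} \<times> {0..1}) (\<lambda>(t, x). ut t x)"
    using assms(1) unfolding C1_strip_def by blast
  have "continuous_on {0..1} (\<lambda>x. case (t, x) of (t, x) \<Rightarrow> ut t x)"
    by (rule continuous_on_compose2[OF cont]) (use assms(2) in \<open>auto intro!: continuous_intros\<close>)
  moreover have "deriv (\<lambda>s. u s x) t = ut t x" if "x \<in> {0..1}" for x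
    using ut[OF assms(2) that] by (rule DERIV_imp_deriv)
  ultimately show ?thesis
    by (simp cong: continuous_on_cong_simp)
qed

lemma C0_L2_shift:
  assumes "C0_L2 u" "t0 \<ge> 0"
  shows "C0_L2 (\<lambda>t. u (t0 + t))"
  unfolding C0_L2_def
proof (intro conjI allI impI)
  fix t :: real assume t: "t \<ge> 0"
  show "u (t0 + t) \<in> L2_space" using assms t by (simp add: C0_L2_def)
  have "((\<lambda>s. L2norm (\<lambda>x. u s x - u (t0 + t) x)) \<longlongrightarrow> 0) (at (t0 + t) within {0..})"
    using assms t by (simp add: C0_L2_def)
  moreover have "filterlim (\<lambda>s. t0 + s) (at (t0 + t) within {0..}) (at t within {0..})"
    unfolding filterlim_at using assms(2)
    by (auto intro!: tendsto_intros simp: eventually_at_filter)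
  ultimately show "((\<lambda>s. L2norm (\<lambda>x. u (t0 + s) x - u (t0 + t) x)) \<longlongrightarrow> 0) (at t within {0..})"
    by (rule filterlim_compose)
qed

lemma C1_strip_shift:
  assumes "C1_strip u" "t0 \<ge> 0"
  shows "C1_strip (\<lambda>t. u (t0 + t))"
proof -
  obtain ut ux where
    ut: "\<And>t x. t > 0 \<Longrightarrow> x \<in> {0..1} \<Longrightarrow> ((\<lambda>s. u s x) has_real_derivative ut t x) (at t)" and
    ux: "\<And>t x. t > 0 \<Longrightarrow> x \<in> {0..1} \<Longrightarrow> (u t has_real_derivative ux t x) (at x within {0..1})" and
    cont: "continuous_on ({0<..} \<times> {0..1}) (\<lambda>(t, x). ut t x)"
      "continuous_on ({0<..} \<times> {0..1}) (\<lambda>(t, x). ux t x)"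
    using assms(1) unfolding C1_strip_def by blast
  have shifted: "continuous_on ({0<..} \<times> {0..1}) (\<lambda>(t, x). h (t0 + t) x)"
    if "continuous_on ({0<..} \<times> {0..1}) (\<lambda>(t, x). h t x)" for h :: "real \<Rightarrow> real \<Rightarrow> real"
  proof -
    have "continuous_on ({0<..} \<times> {0..1}) (\<lambda>z. (\<lambda>(t, x). h t x) (t0 + fst z, snd z))"
      by (rule continuous_on_compose2[OF that])
        (use assms(2) in \<open>auto intro!: continuous_intros\<close>)
    then show ?thesis by (simp add: case_prod_beta)
  qed
  have "((\<lambda>s. u (t0 + s) x) has_real_derivative ut (t0 + t) x) (at t)"
    if "t > 0" "x \<in> {0..1}" for t x
    using ut[of "t0 + t" x] that assms(2) DERIV_shift[of "\<lambda>s. u s x" "ut (t0 + t) x" t t0]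
    by (simp add: add.commute)
  then show ?thesis
    unfolding C1_strip_def using ux shifted[OF cont(1)] shifted[OF cont(2)] assms(2)
    by (intro exI[of _ "\<lambda>t. ut (t0 + t)"] exI[of _ "\<lambda>t. ux (t0 + t)"]) auto
qed

text \<open>Time invariance of the linear loop.\<close>

lemma linear_loop_solution_shift:
  assumes sol: "linear_loop_solution p q k v u" and t0: "t0 \<ge> 0"
  shows "linear_loop_solution p q k (\<lambda>t. v (t0 + t)) (\<lambda>t. u (t0 + t))"
proof -
  have C1: "C1_strip u" and "C0_L2 u" and "\<forall>t>0. C2_unit (u t)"
    using sol by (auto simp: linear_loop_solution_def solution_class_def)
  then have "solution_class (\<lambda>t. u (t0 + t))"
    using t0 by (auto simp: solution_class_def C0_L2_shift C1_strip_shift)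
  moreover have "deriv (\<lambda>s. u (t0 + s) x) t = deriv (\<lambda>s. u s x) (t0 + t)"
    if "t > 0" "x \<in> {0<..<1}" for t x
  proof -
    have "((\<lambda>s. u s x) has_real_derivative deriv (\<lambda>s. u s x) (t + t0)) (at (t + t0))"
      using that t0 by (intro C1_strip_deriv[OF C1]) auto
    then have "((\<lambda>s. u (s + t0) x) has_real_derivative deriv (\<lambda>s. u s x) (t + t0)) (at t)"
      unfolding DERIV_shift .
    then show ?thesis by (simp add: add.commute DERIV_imp_deriv)
  qed
  ultimately show ?thesis
    using sol t0 by (auto simp: linear_loop_solution_def)
qed

text \<open>The state at time \<open>t0\<close> is the initial state of the shifted solution, so the estimate may
  start there, and the input before \<open>t0\<close> no longer enters the supremum. Replacing the supremum by
  an arbitrary upper bound \<open>C\<close> absorbs the boundedness condition.\<close>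

lemma achieves_ISS_restart:
  assumes "achieves_ISS p q k g"
  obtains G \<sigma> where "G > 0" "\<sigma> > 0"
    "\<And>v u t0 t C. \<lbrakk>\<And>s. 0 \<le> s \<Longrightarrow> v s \<in> L2_space; linear_loop_solution p q k v u; 0 \<le> t0; t0 \<le> t;
       \<And>s. s \<in> {t0..t} \<Longrightarrow> L2norm (v s) \<le> C\<rbrakk> \<Longrightarrow>
      L2norm (u t) \<le> G * exp (- \<sigma> * (t - t0)) * L2norm (u t0) + g * C"
proof -
  have g: "g \<ge> 0" using assms by (simp add: achieves_ISS_def)
  obtain G \<sigma> where G: "G > 0" "\<sigma> > 0" and iss: "\<And>v u t. \<lbrakk>\<forall>t\<ge>0. v t \<in> L2_space;
      linear_loop_solution p q k v u; t \<ge> 0; bdd_above ((\<lambda>s. L2norm (v s)) ` {0..t})\<rbrakk> \<Longrightarrow>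
      L2norm (u t) \<le> G * exp (- \<sigma> * t) * L2norm (u 0) + g * (SUP s\<in>{0..t}. L2norm (v s))"
    using assms unfolding achieves_ISS_def by metis
  show thesis
  proof (rule that[OF G])
    fix v u t0 t C
    assume v: "\<And>s. 0 \<le> s \<Longrightarrow> v s \<in> L2_space" and sol: "linear_loop_solution p q k v u"
      and t: "0 \<le> t0" "t0 \<le> t" and C: "\<And>s. s \<in> {t0..t} \<Longrightarrow> L2norm (v s) \<le> C"
    have bound: "L2norm (v (t0 + s)) \<le> C" if "s \<in> {0..t - t0}" for s
      using that by (intro C) auto
    have "L2norm (u (t0 + (t - t0))) \<le> G * exp (- \<sigma> * (t - t0)) * L2norm (u (t0 + 0))
        + g * (SUP s\<in>{0..t - t0}. L2norm (v (t0 + s)))"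
      using v t bound
      by (intro iss[OF _ linear_loop_solution_shift[OF sol t(1)]]) (auto intro!: bdd_aboveI2[where M=C])
    moreover have "(SUP s\<in>{0..t - t0}. L2norm (v (t0 + s))) \<le> C"
      using t bound by (intro cSUP_least) auto
    ultimately show "L2norm (u t) \<le> G * exp (- \<sigma> * (t - t0)) * L2norm (u t0) + g * C"
      using g mult_left_mono by fastforce
  qed
qed

lemma C0_L2_diff_lincomb:
  assumes "C0_L2 u" "\<And>i. i \<in> I \<Longrightarrow> \<phi> i \<in> L2_space" "\<And>i. i \<in> I \<Longrightarrow> continuous_on {0..} (\<xi> i)"
  shows "C0_L2 (\<lambda>t x. u t x - (\<Sum>i\<in>I. \<xi> i t * \<phi> i x))"
  unfolding C0_L2_def
proof (intro conjI allI impI)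
  fix t :: real assume t: "t \<ge> 0"
  have comb: "(\<lambda>x. \<Sum>i\<in>I. c i * \<phi> i x) \<in> L2_space" for c
    using assms(2) by (intro L2_space_sum L2_space_scale)
  have u: "u s \<in> L2_space" if "s \<ge> 0" for s using assms(1) that by (simp add: C0_L2_def)
  show "(\<lambda>x. u t x - (\<Sum>i\<in>I. \<xi> i t * \<phi> i x)) \<in> L2_space"
    using u[OF t] comb by (rule L2_space_diff)
  show "((\<lambda>s. L2norm (\<lambda>x. (u s x - (\<Sum>i\<in>I. \<xi> i s * \<phi> i x))
      - (u t x - (\<Sum>i\<in>I. \<xi> i t * \<phi> i x)))) \<longlongrightarrow> 0) (at t within {0..})"
  proof (rule Lim_null_comparison)
    have "((\<lambda>s. \<bar>\<xi> i s - \<xi> i t\<bar>) \<longlongrightarrow> 0) (at t within {0..})" if "i \<in> I" for i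
      using assms(3)[OF that] t by (auto simp: continuous_on_def LIM_zero tendsto_rabs_zero)
    then have "((\<lambda>s. L2norm (\<lambda>x. u s x - u t x) + (\<Sum>i\<in>I. \<bar>\<xi> i s - \<xi> i t\<bar> * L2norm (\<phi> i)))
        \<longlongrightarrow> 0 + (\<Sum>i\<in>I. 0 * L2norm (\<phi> i))) (at t within {0..})"
      using assms(1) t by (intro tendsto_intros) (auto simp: C0_L2_def)
    then show "((\<lambda>s. L2norm (\<lambda>x. u s x - u t x) + (\<Sum>i\<in>I. \<bar>\<xi> i s - \<xi> i t\<bar> * L2norm (\<phi> i)))
        \<longlongrightarrow> 0) (at t within {0..})" by simp
    have "L2norm (\<lambda>x. (u s x - (\<Sum>i\<in>I. \<xi> i s * \<phi> i x)) - (u t x - (\<Sum>i\<in>I. \<xi> i t * \<phi> i x)))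
        \<le> L2norm (\<lambda>x. u s x - u t x) + (\<Sum>i\<in>I. \<bar>\<xi> i s - \<xi> i t\<bar> * L2norm (\<phi> i))" if s: "s \<ge> 0" for s
    proof -
      have "(\<lambda>x. (u s x - (\<Sum>i\<in>I. \<xi> i s * \<phi> i x)) - (u t x - (\<Sum>i\<in>I. \<xi> i t * \<phi> i x)))
          = (\<lambda>x. (u s x - u t x) - (\<Sum>i\<in>I. (\<xi> i s - \<xi> i t) * \<phi> i x))"
        by (simp add: left_diff_distrib sum_subtractf algebra_simps)
      then show ?thesis
        using L2norm_diff_le[OF L2_space_diff[OF u[OF s] u[OF t]] comb[of "\<lambda>i. \<xi> i s - \<xi> i t"]]
          L2norm_lincomb_le[of I \<phi> "\<lambda>i. \<xi> i s - \<xi> i t"] assms(2) by fastforce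
    qed
    then show "\<forall>\<^sub>F s in at t within {0..}.
        norm (L2norm (\<lambda>x. (u s x - (\<Sum>i\<in>I. \<xi> i s * \<phi> i x)) - (u t x - (\<Sum>i\<in>I. \<xi> i t * \<phi> i x))))
        \<le> L2norm (\<lambda>x. u s x - u t x) + (\<Sum>i\<in>I. \<bar>\<xi> i s - \<xi> i t\<bar> * L2norm (\<phi> i))"
      by (auto simp: eventually_at_filter)
  qed
qed

lemma C1_strip_diff_lincomb:
  assumes "C1_strip u" "\<And>i. i \<in> I \<Longrightarrow> C2_unit (\<phi> i)"
    and "\<And>i. i \<in> I \<Longrightarrow> \<xi> i C1_differentiable_on {0<..}"
  shows "C1_strip (\<lambda>t x. u t x - (\<Sum>i\<in>I. \<xi> i t * \<phi> i x))"
proof -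
  obtain ut ux where
    ut: "\<And>t x. t > 0 \<Longrightarrow> x \<in> {0..1} \<Longrightarrow> ((\<lambda>s. u s x) has_real_derivative ut t x) (at t)" and
    ux: "\<And>t x. t > 0 \<Longrightarrow> x \<in> {0..1} \<Longrightarrow> (u t has_real_derivative ux t x) (at x within {0..1})" and
    cont: "continuous_on ({0<..} \<times> {0..1}) (\<lambda>(t, x). ut t x)"
      "continuous_on ({0<..} \<times> {0..1}) (\<lambda>(t, x). ux t x)"
    using assms(1) unfolding C1_strip_def by blast
  have "\<forall>i. \<exists>h h'. i \<in> I \<longrightarrow>
      (\<forall>x\<in>{0..1}. (\<phi> i has_real_derivative h x) (at x within {0..1})) \<and>
      (\<forall>x\<in>{0..1}. (h has_real_derivative h' x) (at x within {0..1}))"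
    using assms(2) unfolding C2_unit_def by blast
  then obtain h h' where
    h: "\<And>i x. i \<in> I \<Longrightarrow> x \<in> {0..1} \<Longrightarrow> (\<phi> i has_real_derivative h i x) (at x within {0..1})"
    and h': "\<And>i x. i \<in> I \<Longrightarrow> x \<in> {0..1} \<Longrightarrow> (h i has_real_derivative h' i x) (at x within {0..1})"
    by metis
  have "\<forall>i. \<exists>D. i \<in> I \<longrightarrow> (\<forall>t>0. (\<xi> i has_real_derivative D t) (at t)) \<and> continuous_on {0<..} D"
    using assms(3) unfolding C1_differentiable_on_def
    by (simp add: has_real_derivative_iff_has_vector_derivative) blast
  then obtain D where
    D: "\<And>i t. i \<in> I \<Longrightarrow> t > 0 \<Longrightarrow> (\<xi> i has_real_derivative D i t) (at t)"
      "\<And>i. i \<in> I \<Longrightarrow> continuous_on {0<..} (D i)"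
    by metis
  have cont_t: "continuous_on ({0<..} \<times> {0..1}) (\<lambda>z :: real \<times> real. e (fst z))"
    if "continuous_on {0<..} e" for e :: "real \<Rightarrow> real"
    by (rule continuous_on_compose2[OF that]) (auto intro!: continuous_intros)
  have cont_x: "continuous_on ({0<..} \<times> {0..1}) (\<lambda>z :: real \<times> real. e (snd z))"
    if "continuous_on {0..1} e" for e :: "real \<Rightarrow> real"
    by (rule continuous_on_compose2[OF that]) (auto intro!: continuous_intros)
  have cont_\<xi>: "continuous_on {0<..} (\<xi> i)" if "i \<in> I" for i
    using D(1)[OF that] by (intro DERIV_continuous_on[where D="D i"]) (auto intro: has_field_derivative_at_within)
  have cont_\<phi>: "continuous_on {0..1} (\<phi> i)" "continuous_on {0..1} (h i)" if "i \<in> I" for i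
    using DERIV_continuous_on[OF h[OF that]] DERIV_continuous_on[OF h'[OF that]]
    by blast+
  have dt: "((\<lambda>s. u s x - (\<Sum>i\<in>I. \<xi> i s * \<phi> i x)) has_real_derivative
      ut t x - (\<Sum>i\<in>I. D i t * \<phi> i x)) (at t)" if "t > 0" "x \<in> {0..1}" for t x
    using that by (intro DERIV_diff DERIV_sum DERIV_cmult_right ut D)
  have dx: "((\<lambda>x. u t x - (\<Sum>i\<in>I. \<xi> i t * \<phi> i x)) has_real_derivative
      ux t x - (\<Sum>i\<in>I. \<xi> i t * h i x)) (at x within {0..1})" if "t > 0" "x \<in> {0..1}" for t x
    using that by (intro DERIV_diff DERIV_sum DERIV_cmult ux h)
  have ct: "continuous_on ({0<..} \<times> {0..1}) (\<lambda>(t, x). ut t x - (\<Sum>i\<in>I. D i t * \<phi> i x))"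
    using cont(1) unfolding case_prod_beta
    by (intro continuous_intros cont_t cont_x D cont_\<phi>)
  have cx: "continuous_on ({0<..} \<times> {0..1}) (\<lambda>(t, x). ux t x - (\<Sum>i\<in>I. \<xi> i t * h i x))"
    using cont(2) unfolding case_prod_beta
    by (intro continuous_intros cont_t cont_x cont_\<xi> cont_\<phi>)
  show ?thesis
    unfolding C1_strip_def
    by (rule exI[of _ "\<lambda>t x. ut t x - (\<Sum>i\<in>I. D i t * \<phi> i x)"],
        rule exI[of _ "\<lambda>t x. ux t x - (\<Sum>i\<in>I. \<xi> i t * h i x)"],
        intro conjI allI impI ballI dt dx ct cx)
qed

section \<open>The change of variables and the closed loop\<close>

lemma closed_loop_solution_filter:
  assumes "closed_loop_solution p q k f n \<phi> K \<omega> u \<xi>" "i \<in> {1..n}" "t > 0"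
  shows "(\<xi> i has_real_derivative - (\<omega> i)\<^sup>2 * \<xi> i t + K i (u t)) (at t)"
proof -
  have "\<xi> i C1_differentiable_on {0<..}"
    and ode: "deriv (\<xi> i) t = - (\<omega> i)\<^sup>2 * \<xi> i t + K i (u t)"
    using assms by (auto simp: closed_loop_solution_def)
  then obtain D where "(\<xi> i has_real_derivative D) (at t)"
    using assms(3) by (auto simp: C1_differentiable_on_def has_real_derivative_iff_has_vector_derivative)
  then show ?thesis using DERIV_imp_deriv ode by metis
qed

text \<open>The reduction behind the controller. Differentiating \<open>\<xi> i t * \<phi> i x\<close> in time produces
  \<open>\<phi> i x * K i (u t)\<close>, which cancels the leading part of \<open>f\<close>, and \<open>- (\<omega> i)\<^sup>2 * \<xi> i t * \<phi> i x\<close>, which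
  together with the spatial operator applied to \<open>\<phi> i\<close> gives \<open>\<xi> i t * \<psi> i x\<close>. The conditions
  \<open>\<phi> i 0 = 0\<close> and the two \<open>\<xi>\<close>-terms of the feedback law yield the boundary conditions.\<close>

lemma closed_loop_reduces_to_linear_loop:
  fixes p q :: real and \<phi> :: "nat \<Rightarrow> real \<Rightarrow> real" and \<omega> :: "nat \<Rightarrow> real"
  defines "\<psi> \<equiv> \<lambda>i x. p * (deriv ^^ 2) (\<phi> i) x - (q - (\<omega> i)\<^sup>2) * \<phi> i x"
  assumes sol: "closed_loop_solution p q k f n \<phi> K \<omega> u \<xi>"
    and k: "continuous_on {0..1} k"
    and f: "\<And>w. w \<in> L2_space \<Longrightarrow> f w \<in> L2_space"
    and \<phi>: "\<And>i. i \<in> {1..n} \<Longrightarrow> C2_unit (\<phi> i)" "\<And>i. i \<in> {1..n} \<Longrightarrow> \<phi> i 0 = 0"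
    and fM: "\<And>w. w \<in> L2_space \<Longrightarrow>
           L2norm (\<lambda>x. f w x - (\<Sum>i=1..n. \<phi> i x * K i w)) \<le> M * L2norm w"
  obtains v where "\<And>t. 0 \<le> t \<Longrightarrow> v t \<in> L2_space"
    "linear_loop_solution p q k v (\<lambda>t x. u t x - (\<Sum>i=1..n. \<xi> i t * \<phi> i x))"
    "\<And>t. 0 \<le> t \<Longrightarrow> L2norm (v t) \<le> M * L2norm (u t) + (\<Sum>i=1..n. L2norm (\<psi> i) * \<bar>\<xi> i t\<bar>)"
proof -
  have C0: "C0_L2 u" and C1: "C1_strip u" and C2: "\<And>t. t > 0 \<Longrightarrow> C2_unit (u t)"
    using sol by (auto simp: closed_loop_solution_def solution_class_def)
  have \<xi>: "\<And>i. i \<in> {1..n} \<Longrightarrow> continuous_on {0..} (\<xi> i)"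
    "\<And>i. i \<in> {1..n} \<Longrightarrow> \<xi> i C1_differentiable_on {0<..}"
    using sol by (auto simp: closed_loop_solution_def)
  have \<xi>_ode: "(\<xi> i has_real_derivative - (\<omega> i)\<^sup>2 * \<xi> i t + K i (u t)) (at t)"
    if "i \<in> {1..n}" "t > 0" for i t
    using closed_loop_solution_filter[OF sol that] .
  have cont_\<phi>: "continuous_on {0..1} (\<phi> i)" if "i \<in> {1..n}" for i
    using \<phi>(1)[OF that] by (rule C2_unit_imp_continuous)
  have \<phi>_L2: "\<phi> i \<in> L2_space" if "i \<in> {1..n}" for i
    using cont_\<phi>[OF that] by (rule continuous_in_L2_space)
  have \<psi>_L2: "\<psi> i \<in> L2_space" if i: "i \<in> {1..n}" for i
  proof -
    obtain g where g: "continuous_on {0..1} g" "\<And>x. x \<in> {0<..<1} \<Longrightarrow> (deriv ^^ 2) (\<phi> i) x = g x"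
      using C2_unit_second_deriv[OF \<phi>(1)[OF i]] by blast
    have "(\<lambda>x. p * g x - (q - (\<omega> i)\<^sup>2) * \<phi> i x) \<in> L2_space"
      using g(1) cont_\<phi>[OF i] by (intro continuous_in_L2_space continuous_intros)
    then show ?thesis
      unfolding \<psi>_def using g(2) by (subst L2_space_cong) auto
  qed
  have u_L2: "u t \<in> L2_space" if "t \<ge> 0" for t using C0 that by (simp add: C0_L2_def)
  define w where "w t x = u t x - (\<Sum>i=1..n. \<xi> i t * \<phi> i x)" for t x
  have w_eq: "w = (\<lambda>t x. u t x - (\<Sum>i=1..n. \<xi> i t * \<phi> i x))"
    unfolding w_def ..
  have w_C0: "C0_L2 w" unfolding w_eq using C0 \<phi>_L2 \<xi>(1) by (rule C0_L2_diff_lincomb)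
  have w_C1: "C1_strip w" unfolding w_eq using C1 \<phi>(1) \<xi>(2) by (rule C1_strip_diff_lincomb)
  have w_C2: "C2_unit (w t)" if "t > 0" for t
    unfolding w_eq using C2[OF that] \<phi>(1) by (rule C2_unit_diff_lincomb)
  define h where "h t x = (f (u t) x - (\<Sum>i=1..n. \<phi> i x * K i (u t))) + (\<Sum>i=1..n. \<xi> i t * \<psi> i x)" for t x
  have h: "h t \<in> L2_space \<and> L2norm (h t) \<le> M * L2norm (u t) + (\<Sum>i=1..n. L2norm (\<psi> i) * \<bar>\<xi> i t\<bar>)"
    if "t \<ge> 0" for t
  proof -
    have 1: "(\<lambda>x. f (u t) x - (\<Sum>i=1..n. \<phi> i x * K i (u t))) \<in> L2_space"
      unfolding mult.commute[of "\<phi> _ _"]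
      using f u_L2[OF that] \<phi>_L2 by (intro L2_space_diff L2_space_sum L2_space_scale) auto
    have 2: "(\<lambda>x. \<Sum>i=1..n. \<xi> i t * \<psi> i x) \<in> L2_space"
      using \<psi>_L2 by (intro L2_space_sum L2_space_scale)
    have "L2norm (\<lambda>x. \<Sum>i=1..n. \<xi> i t * \<psi> i x) \<le> (\<Sum>i=1..n. \<bar>\<xi> i t\<bar> * L2norm (\<psi> i))"
      using \<psi>_L2 by (rule L2norm_lincomb_le)
    then show ?thesis
      using L2_space_add[OF 1 2] L2norm_triangle[OF 1 2] fM[OF u_L2[OF that]]
      unfolding h_def by (simp add: mult.commute)
  qed
  \<comment> \<open>For \<open>t > 0\<close> the input is read off from the equation, which the linear loop requires at every
    point \<open>x\<close>, whereas the closed loop determines \<open>f (u t)\<close>, hence \<open>h t\<close>, only almost everywhere. At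
    \<open>t = 0\<close>, where no equation holds, \<open>h 0\<close> keeps the norm bound valid.\<close>
  define v where "v t = (if t > 0
      then (\<lambda>x. deriv (\<lambda>s. w s x) t - p * (deriv ^^ 2) (w t) x + q * w t x) else h t)" for t
  have v_L2: "v t \<in> L2_space" if t: "t > 0" for t
  proof -
    obtain g where g: "continuous_on {0..1} g" "\<And>x. x \<in> {0<..<1} \<Longrightarrow> (deriv ^^ 2) (w t) x = g x"
      using C2_unit_second_deriv[OF w_C2[OF t]] by blast
    have "(\<lambda>x. deriv (\<lambda>s. w s x) t - p * g x + q * w t x) \<in> L2_space"
      using g(1) C1_strip_continuous_deriv[OF w_C1 t] C2_unit_imp_continuous[OF w_C2[OF t]]
      by (intro continuous_in_L2_space continuous_intros)
    then show ?thesis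
      using t g(2) unfolding v_def by (subst L2_space_cong) auto
  qed
  have v_AE: "AE x in unit_lebesgue. v t x = h t x" if t: "t > 0" for t
  proof -
    have "AE x in unit_lebesgue.
        deriv (\<lambda>s. u s x) t = p * (deriv ^^ 2) (u t) x - q * u t x + f (u t) x"
      using sol t by (simp add: closed_loop_solution_def)
    moreover have "AE x in unit_lebesgue. x \<in> {0<..<1}"
      using AE_space[of unit_lebesgue] by simp
    ultimately show ?thesis
    proof eventually_elim
      fix x :: real
      assume pde: "deriv (\<lambda>s. u s x) t = p * (deriv ^^ 2) (u t) x - q * u t x + f (u t) x"
        and x: "x \<in> {0<..<1}"
      have "((\<lambda>s. w s x) has_real_derivative
          deriv (\<lambda>s. u s x) t - (\<Sum>i=1..n. (- (\<omega> i)\<^sup>2 * \<xi> i t + K i (u t)) * \<phi> i x)) (at t)"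
        unfolding w_def using t x
        by (intro DERIV_diff DERIV_sum DERIV_cmult_right C1_strip_deriv[OF C1] \<xi>_ode) auto
      then have wt: "deriv (\<lambda>s. w s x) t =
          deriv (\<lambda>s. u s x) t - (\<Sum>i=1..n. (- (\<omega> i)\<^sup>2 * \<xi> i t + K i (u t)) * \<phi> i x)"
        by (rule DERIV_imp_deriv)
      have wxx: "(deriv ^^ 2) (w t) x
          = (deriv ^^ 2) (u t) x - (\<Sum>i=1..n. \<xi> i t * (deriv ^^ 2) (\<phi> i) x)"
        unfolding w_eq using C2[OF t] \<phi>(1) x by (rule C2_unit_diff_lincomb)
      have "v t x = deriv (\<lambda>s. w s x) t - p * (deriv ^^ 2) (w t) x + q * w t x"
        using t by (simp add: v_def)
      also have "\<dots> = f (u t) x + (\<Sum>i=1..n. p * (\<xi> i t * (deriv ^^ 2) (\<phi> i) x)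
          - (- (\<omega> i)\<^sup>2 * \<xi> i t + K i (u t)) * \<phi> i x - q * (\<xi> i t * \<phi> i x))"
        unfolding wt wxx pde
        by (simp add: w_def sum_subtractf right_diff_distrib flip: sum_distrib_left)
      also have "\<dots> = f (u t) x + (\<Sum>i=1..n. \<xi> i t * \<psi> i x - \<phi> i x * K i (u t))"
        by (intro arg_cong2[where f="(+)"] sum.cong) (auto simp: \<psi>_def algebra_simps)
      also have "\<dots> = h t x"
        by (simp add: h_def sum_subtractf)
      finally show "v t x = h t x" .
    qed
  qed
  have v: "v t \<in> L2_space \<and> L2norm (v t) \<le> M * L2norm (u t) + (\<Sum>i=1..n. L2norm (\<psi> i) * \<bar>\<xi> i t\<bar>)"
    if "t \<ge> 0" for t
  proof (cases "t > 0")
    case True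
    have "L2norm (v t) = L2norm (h t)"
      using v_L2[OF True] h[OF that] v_AE[OF True]
      by (intro L2norm_cong_AE) (auto simp: L2_space_def)
    then show ?thesis using v_L2[OF True] h[OF that] by simp
  next
    case False
    then have "v t = h t" by (simp add: v_def)
    then show ?thesis using h[OF that] by simp
  qed
  have "linear_loop_solution p q k v w"
    unfolding linear_loop_solution_def
  proof (intro conjI allI ballI impI)
    show "solution_class w" using w_C0 w_C1 w_C2 by (simp add: solution_class_def)
    fix t :: real assume t: "t > 0"
    show "deriv (\<lambda>s. w s x) t = p * (deriv ^^ 2) (w t) x - q * w t x + v t x" for x
      using t by (simp add: v_def)
    show "w t 0 = 0"
      using sol t \<phi>(2) by (simp add: w_def closed_loop_solution_def)
    have int_u: "integrable unit_lebesgue (\<lambda>x. k x * u t x)"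
      using k C2_unit_imp_continuous[OF C2[OF t]]
      by (intro continuous_imp_integrable_unit continuous_intros)
    have int_\<phi>: "integrable unit_lebesgue (\<lambda>x. \<phi> i x * k x)" if "i \<in> {1..n}" for i
      using k cont_\<phi>[OF that] by (intro continuous_imp_integrable_unit continuous_intros)
    have "(LINT x|unit_lebesgue. k x * w t x)
        = (LINT x|unit_lebesgue. k x * u t x - (\<Sum>i=1..n. \<xi> i t * (\<phi> i x * k x)))"
      by (intro Bochner_Integration.integral_cong)
        (simp_all add: w_def right_diff_distrib sum_distrib_left mult_ac)
    also have "\<dots> = (LINT x|unit_lebesgue. k x * u t x)
        - (\<Sum>i=1..n. \<xi> i t * (LINT x|unit_lebesgue. \<phi> i x * k x))"
    proof -
      have int: "integrable unit_lebesgue (\<lambda>x. \<xi> i t * (\<phi> i x * k x))" if "i \<in> {1..n}" for i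
        using int_\<phi>[OF that] by simp
      have "(LINT x|unit_lebesgue. (\<Sum>i=1..n. \<xi> i t * (\<phi> i x * k x)))
          = (\<Sum>i=1..n. (LINT x|unit_lebesgue. \<xi> i t * (\<phi> i x * k x)))"
        using int by (rule Bochner_Integration.integral_sum)
      then show ?thesis
        using Bochner_Integration.integral_diff[OF int_u Bochner_Integration.integrable_sum[OF int, of "{1..n}"]]
        by simp
    qed
    also have "\<dots> = w t 1"
      using sol t by (simp add: w_def closed_loop_solution_def mult.commute)
    finally show "w t 1 = (LINT x|unit_lebesgue. k x * w t x)" by simp
  qed
  then show thesis
    using v by (intro that[of v]) (auto simp: w_eq)
qed

theorem theorem4p1:
  fixes p q \<gamma> M :: real and k :: "real \<Rightarrow> real"
    and f :: "(real \<Rightarrow> real) \<Rightarrow> (real \<Rightarrow> real)"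
    and n :: nat
    and \<phi> :: "nat \<Rightarrow> real \<Rightarrow> real"
    and K :: "nat \<Rightarrow> (real \<Rightarrow> real) \<Rightarrow> real"
    and P \<omega> :: "nat \<Rightarrow> real"
  assumes "p > 0"
    and "\<gamma> / (p * pi\<^sup>2) \<ge> 0"
    and "achieves_ISS p q k (\<gamma> / (p * pi\<^sup>2))"
    and "L2_continuous_map f"
    and "\<And>i. i \<in> {1..n} \<Longrightarrow> C2_unit (\<phi> i)"
    and "\<And>i. i \<in> {1..n} \<Longrightarrow> \<phi> i 0 = 0"
    and "\<And>i. i \<in> {1..n} \<Longrightarrow> L2_continuous_functional (K i)"
    and "M \<ge> 0"
    and "\<And>i. i \<in> {1..n} \<Longrightarrow> P i \<ge> 0"
    and "\<And>i. i \<in> {1..n} \<Longrightarrow> \<omega> i > 0"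
    and "\<And>i w. i \<in> {1..n} \<Longrightarrow> w \<in> L2_space \<Longrightarrow> \<bar>K i w\<bar> \<le> P i * L2norm w"
    and "\<And>w. w \<in> L2_space \<Longrightarrow>
           L2norm (\<lambda>x. f w x - (\<Sum>i=1..n. \<phi> i x * K i w)) \<le> M * L2norm w"
    and "\<gamma> / (p * pi\<^sup>2) *
           (M + (\<Sum>i=1..n. inverse ((\<omega> i)\<^sup>2) * P i *
                   L2norm (\<lambda>x. p * (deriv ^^ 2) (\<phi> i) x - (q - (\<omega> i)\<^sup>2) * \<phi> i x)))
         + (\<Sum>i=1..n. inverse ((\<omega> i)\<^sup>2) * P i * L2norm (\<phi> i)) < 1"
  shows "\<exists>R>0. \<exists>\<delta>>0. \<forall>u \<xi>. closed_loop_solution p q k f n \<phi> K \<omega> u \<xi> \<longrightarrow>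
           (\<forall>t\<ge>0. L2norm (u t) + (\<Sum>i=1..n. \<bar>\<xi> i t\<bar>)
                    \<le> R * exp (- \<delta> * t) * (L2norm (u 0) + (\<Sum>i=1..n. \<bar>\<xi> i 0\<bar>)))"
proof -
  define g where "g = \<gamma> / (p * pi\<^sup>2)"
  define \<psi> where "\<psi> = (\<lambda>i x. p * (deriv ^^ 2) (\<phi> i) x - (q - (\<omega> i)\<^sup>2) * \<phi> i x)"
  have g: "g \<ge> 0" and iss: "achieves_ISS p q k g"
    using assms(2,3) by (simp_all add: g_def)
  have k: "continuous_on {0..1} k" using iss by (simp add: achieves_ISS_def)
  obtain G \<sigma> where G: "G > 0" "\<sigma> > 0" and restart:
    "\<And>v u t0 t C. \<lbrakk>\<And>s. 0 \<le> s \<Longrightarrow> v s \<in> L2_space; linear_loop_solution p q k v u; 0 \<le> t0; t0 \<le> t;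
       \<And>s. s \<in> {t0..t} \<Longrightarrow> L2norm (v s) \<le> C\<rbrakk> \<Longrightarrow>
      L2norm (u t) \<le> G * exp (- \<sigma> * (t - t0)) * L2norm (u t0) + g * C"
    using achieves_ISS_restart[OF iss] by metis
  have \<phi>_L2: "\<phi> i \<in> L2_space" if "i \<in> {1..n}" for i
    using assms(5)[OF that] by (intro continuous_in_L2_space C2_unit_imp_continuous)
  have f_L2: "f w \<in> L2_space" if "w \<in> L2_space" for w
    using assms(4) that by (simp add: L2_continuous_map_def)
  have gain: "g * (M + (\<Sum>i\<in>{1..n}. P i * L2norm (\<psi> i) / (\<omega> i)\<^sup>2))
      + (\<Sum>i\<in>{1..n}. P i * L2norm (\<phi> i) / (\<omega> i)\<^sup>2) < 1"
    using assms(13) by (simp add: g_def \<psi>_def divide_inverse mult_ac)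
  obtain R \<delta> where R: "R > 0" "\<delta> > 0" and decay:
    "\<And>(N :: real \<Rightarrow> real) a b \<xi> \<kappa> t.
      \<lbrakk>continuous_on {0..} N; \<And>s. 0 \<le> s \<Longrightarrow> 0 \<le> N s; \<And>s. 0 \<le> s \<Longrightarrow> 0 \<le> a s;
       \<And>t0 t C. \<lbrakk>0 \<le> t0; t0 \<le> t; \<And>s. s \<in> {t0..t} \<Longrightarrow> b s \<le> C\<rbrakk> \<Longrightarrow>
         a t \<le> G * exp (- \<sigma> * (t - t0)) * a t0 + g * C;
       \<And>s. 0 \<le> s \<Longrightarrow> b s \<le> M * N s + (\<Sum>i\<in>{1..n}. L2norm (\<psi> i) * \<bar>\<xi> i s\<bar>);
       \<And>s. 0 \<le> s \<Longrightarrow> N s \<le> a s + (\<Sum>i\<in>{1..n}. L2norm (\<phi> i) * \<bar>\<xi> i s\<bar>);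
       a 0 \<le> N 0 + (\<Sum>i\<in>{1..n}. L2norm (\<phi> i) * \<bar>\<xi> i 0\<bar>);
       \<And>i. i \<in> {1..n} \<Longrightarrow> continuous_on {0..} (\<xi> i);
       \<And>i s. i \<in> {1..n} \<Longrightarrow> 0 < s \<Longrightarrow>
         (\<xi> i has_real_derivative - (\<omega> i)\<^sup>2 * \<xi> i s + \<kappa> i s) (at s);
       \<And>i s. i \<in> {1..n} \<Longrightarrow> 0 < s \<Longrightarrow> \<bar>\<kappa> i s\<bar> \<le> P i * N s; 0 \<le> t\<rbrakk> \<Longrightarrow>
      N t + (\<Sum>i\<in>{1..n}. \<bar>\<xi> i t\<bar>) \<le> R * exp (- \<delta> * t) * (N 0 + (\<Sum>i\<in>{1..n}. \<bar>\<xi> i 0\<bar>))"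
    by (rule small_gain_decay[where I="{1..n}" and P=P and c="\<lambda>i. L2norm (\<psi> i)"
          and d="\<lambda>i. L2norm (\<phi> i)" and \<rho>="\<lambda>i. (\<omega> i)\<^sup>2", OF _ G g assms(8) assms(9) _ _ _ gain])
      (use assms(10) in \<open>auto simp: less_imp_neq[THEN not_sym]\<close>)
  show ?thesis
  proof (intro exI conjI allI impI)
    show "R > 0" "\<delta> > 0" using R .
    fix u \<xi> t
    assume sol: "closed_loop_solution p q k f n \<phi> K \<omega> u \<xi>" and t: "0 \<le> (t::real)"
    define w where "w t x = u t x - (\<Sum>i=1..n. \<xi> i t * \<phi> i x)" for t x
    have w_eq: "w = (\<lambda>t x. u t x - (\<Sum>i=1..n. \<xi> i t * \<phi> i x))"
      unfolding w_def ..
    obtain v where v: "\<And>t. 0 \<le> t \<Longrightarrow> v t \<in> L2_space" "linear_loop_solution p q k v w"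
      "\<And>t. 0 \<le> t \<Longrightarrow> L2norm (v t) \<le> M * L2norm (u t) + (\<Sum>i=1..n. L2norm (\<psi> i) * \<bar>\<xi> i t\<bar>)"
      using closed_loop_reduces_to_linear_loop[OF sol k f_L2 assms(5,6,12)]
      unfolding w_eq \<psi>_def by blast
    have C0: "C0_L2 u" using sol by (simp add: closed_loop_solution_def solution_class_def)
    then have u_L2: "u s \<in> L2_space" if "s \<ge> 0" for s using that by (simp add: C0_L2_def)
    have comb_L2: "(\<lambda>x. \<Sum>i=1..n. \<xi> i s * \<phi> i x) \<in> L2_space" for s
      using \<phi>_L2 by (intro L2_space_sum L2_space_scale)
    have comb_norm: "L2norm (\<lambda>x. \<Sum>i=1..n. \<xi> i s * \<phi> i x) \<le> (\<Sum>i=1..n. L2norm (\<phi> i) * \<bar>\<xi> i s\<bar>)" for s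
      using L2norm_lincomb_le[of "{1..n}" \<phi> "\<lambda>i. \<xi> i s"] \<phi>_L2 by (simp add: mult.commute)
    have w_le: "L2norm (w s) \<le> L2norm (u s) + (\<Sum>i=1..n. L2norm (\<phi> i) * \<bar>\<xi> i s\<bar>)" if "s \<ge> 0" for s
      using L2norm_diff_le[OF u_L2[OF that] comb_L2[of s]] comb_norm[of s] by (simp add: w_eq)
    have u_le: "L2norm (u s) \<le> L2norm (w s) + (\<Sum>i=1..n. L2norm (\<phi> i) * \<bar>\<xi> i s\<bar>)" if "s \<ge> 0" for s
      using L2norm_triangle[OF L2_space_diff[OF u_L2[OF that] comb_L2[of s]] comb_L2[of s]]
        comb_norm[of s] by (simp add: w_eq)
    show "L2norm (u t) + (\<Sum>i=1..n. \<bar>\<xi> i t\<bar>)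
        \<le> R * exp (- \<delta> * t) * (L2norm (u 0) + (\<Sum>i=1..n. \<bar>\<xi> i 0\<bar>))"
    proof (rule decay[where a="\<lambda>s. L2norm (w s)" and b="\<lambda>s. L2norm (v s)" and \<kappa>="\<lambda>i s. K i (u s)"])
      show "continuous_on {0..} (\<lambda>t. L2norm (u t))" using C0 by (rule continuous_on_L2norm_profile)
      show "L2norm (w t) \<le> G * exp (- \<sigma> * (t - t0)) * L2norm (w t0) + g * C"
        if "0 \<le> t0" "t0 \<le> t" "\<And>s. s \<in> {t0..t} \<Longrightarrow> L2norm (v s) \<le> C" for t0 t C
        using v(1,2) that by (rule restart)
      show "continuous_on {0..} (\<xi> i)" if "i \<in> {1..n}" for i
        using sol that by (simp add: closed_loop_solution_def)
      show "(\<xi> i has_real_derivative - (\<omega> i)\<^sup>2 * \<xi> i s + K i (u s)) (at s)"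
        if "i \<in> {1..n}" "0 < s" for i s
        using sol that by (rule closed_loop_solution_filter)
      show "\<bar>K i (u s)\<bar> \<le> P i * L2norm (u s)" if "i \<in> {1..n}" "0 < s" for i s
        using assms(11)[OF that(1) u_L2] that(2) by simp
    qed (use v(3) u_le w_le t in auto)
  qed
qed

end
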